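(* Let $(X,m,\sigma)$ be a (Hausdorff) topological median algebra all of whose intervals $[u,v]$ are compact in $\sigma$, and such that $(X,m)\in(T^m_2)$. Denote by $\nu\colon(X,\sigma)\to X^{RF}$ the Roller--Fioravanti (RF) compactification. Then, regarded as a compactification of $(X,\tau_{\mathrm m})$, the map $\nu\colon(X,\tau_{\mathrm m})\hookrightarrow X^{RF}$ is canonically isomorphic to the minimal median compactification (MMC) of $X$. Moreover, the topology on $X$ inherited from $X^{RF}$ is precisely $\tau_{\mathrm m}$.
   Context: A median algebra is a set $X$ with a ternary operation $m\colon X^3\to X$ that is symmetric in all variables and satisfies $m(a,b,b)=b$ and $m(m(a,x,b),x,c)=m(a,x,m(b,x,c))$. A topological median algebra is a Hausdorff topological space with a continuous median operation. Intervals: $[x,y]=\{z: m(x,y,z)=z\}$. A subalgebra is a chain if it carries a linear order $\le$ for which $m(a,b,c)=b$ whenever $a\le b\le c$. Canonical retraction: $\phi_{u,v}\colon X\to[u,v]$, $\phi_{u,v}(z)=m(u,z,v)$. Branches: $B^u_v=\{x: m(u,x,v)\neq v\}$. The median uniformity $\mathcal U_{\mathrm m}$ is the covering uniformity with uniform subbase all two-member covers $\{B^u_v,B^v_u\}$, where $[u,v]$ runs over all chain intervals with $u\neq v$: a cover belongs to $\mathcal U_{\mathrm m}$ iff it is refined by a finite common refinement of such covers. Its topology is $\tau_{\mathrm m}$. $X\in(T^m_2)$ means: for all $x\ne y$ there is a chain interval $[u,v]$, $u\neq v$, with $\{\phi_{u,v}(x),\phi_{u,v}(y)\}=\{u,v\}$;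 equivalently $\mathcal U_{\mathrm m}$ is Hausdorff. In that case the MMC $\widehat X$ is the Hausdorff completion of $(X,\mathcal U_{\mathrm m})$, a compact Hausdorff topological median algebra with the unique continuous extension of $m$. RF compactification: when all intervals are $\sigma$-compact, $\nu\colon X\to\prod_{u,v\in X}[u,v]$ is the diagonal map $\nu(x)=(\phi_{u,v}(x))_{u,v}$ (each $[u,v]$ carrying the compact topology $\sigma|_{[u,v]}$, the product carrying the product topology and coordinatewise median), and $X^{RF}$ is the closure of $\nu(X)$. It is an injective $\sigma$-continuous median homomorphism, not necessarily a topological embedding. Isomorphism of compactifications means a homeomorphic median isomorphism commuting with the maps from $X$. *)

theory Defs
  imports "HOL-Analysis.Analysis"
begin

section \<open>Median algebras\<close>

locale median_algebra =
  fixes X :: "'a set" and m :: "'a \<Rightarrow> 'a \<Rightarrow> 'a \<Rightarrow> 'a"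
  assumes median_closed: "\<lbrakk>a \<in> X; b \<in> X; c \<in> X\<rbrakk> \<Longrightarrow> m a b c \<in> X"
    and median_swap12: "\<lbrakk>a \<in> X; b \<in> X; c \<in> X\<rbrakk> \<Longrightarrow> m a b c = m b a c"
    and median_swap23: "\<lbrakk>a \<in> X; b \<in> X; c \<in> X\<rbrakk> \<Longrightarrow> m a b c = m a c b"
    and median_absorb: "\<lbrakk>a \<in> X; b \<in> X\<rbrakk> \<Longrightarrow> m a b b = b"
    and median_assoc: "\<lbrakk>a \<in> X; b \<in> X; c \<in> X; x \<in> X\<rbrakk>
      \<Longrightarrow> m (m a x b) x c = m a x (m b x c)"

definition topological_median_algebra :: "'a topology \<Rightarrow> ('a \<Rightarrow> 'a \<Rightarrow> 'a \<Rightarrow> 'a) \<Rightarrow> bool" where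
  "topological_median_algebra T m \<longleftrightarrow>
     median_algebra (topspace T) m \<and> Hausdorff_space T \<and>
     continuous_map (prod_topology T (prod_topology T T)) T (\<lambda>(x, y, z). m x y z)"

definition median_interval :: "'a set \<Rightarrow> ('a \<Rightarrow> 'a \<Rightarrow> 'a \<Rightarrow> 'a) \<Rightarrow> 'a \<Rightarrow> 'a \<Rightarrow> 'a set" where
  "median_interval X m x y = {z \<in> X. m x y z = z}"

definition median_subalgebra :: "'a set \<Rightarrow> ('a \<Rightarrow> 'a \<Rightarrow> 'a \<Rightarrow> 'a) \<Rightarrow> 'a set \<Rightarrow> bool" where
  "median_subalgebra X m C \<longleftrightarrow> C \<subseteq> X \<and> (\<forall>a\<in>C. \<forall>b\<in>C. \<forall>c\<in>C. m a b c \<in> C)"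

definition median_chain :: "'a set \<Rightarrow> ('a \<Rightarrow> 'a \<Rightarrow> 'a \<Rightarrow> 'a) \<Rightarrow> 'a set \<Rightarrow> bool" where
  "median_chain X m C \<longleftrightarrow> median_subalgebra X m C \<and>
     (\<exists>r. linear_order_on C r \<and>
        (\<forall>a\<in>C. \<forall>b\<in>C. \<forall>c\<in>C. (a, b) \<in> r \<and> (b, c) \<in> r \<longrightarrow> m a b c = b))"

text \<open>The pairs \<open>(u, v)\<close> for which \<open>[u, v]\<close> is a nondegenerate chain interval.\<close>

definition chain_pairs :: "'a set \<Rightarrow> ('a \<Rightarrow> 'a \<Rightarrow> 'a \<Rightarrow> 'a) \<Rightarrow> ('a \<times> 'a) set" where
  "chain_pairs X m =
     {(u, v). u \<in> X \<and> v \<in> X \<and> u \<noteq> v \<and> median_chain X m (median_interval X m u v)}"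

definition median_retraction :: "('a \<Rightarrow> 'a \<Rightarrow> 'a \<Rightarrow> 'a) \<Rightarrow> 'a \<Rightarrow> 'a \<Rightarrow> 'a \<Rightarrow> 'a" where
  "median_retraction m u v z = m u z v"

definition branch :: "'a set \<Rightarrow> ('a \<Rightarrow> 'a \<Rightarrow> 'a \<Rightarrow> 'a) \<Rightarrow> 'a \<Rightarrow> 'a \<Rightarrow> 'a set" where
  "branch X m u v = {x \<in> X. m u x v \<noteq> v}"

definition T2m :: "'a set \<Rightarrow> ('a \<Rightarrow> 'a \<Rightarrow> 'a \<Rightarrow> 'a) \<Rightarrow> bool" where
  "T2m X m \<longleftrightarrow> (\<forall>x\<in>X. \<forall>y\<in>X. x \<noteq> y \<longrightarrow>
     (\<exists>(u, v) \<in> chain_pairs X m. {median_retraction m u v x, median_retraction m u v y} = {u, v}))"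


section \<open>Covering uniformities\<close>

definition refines :: "'a set set \<Rightarrow> 'a set set \<Rightarrow> bool" where
  "refines \<C> \<D> \<longleftrightarrow> (\<forall>A\<in>\<C>. \<exists>B\<in>\<D>. A \<subseteq> B)"

definition covers_of :: "'a set \<Rightarrow> 'a set set set" where
  "covers_of X = {\<C>. \<C> \<subseteq> Pow X \<and> \<Union>\<C> = X}"

text \<open>The members are the intersections of one member from each cover in \<open>\<S>\<close>;
  for \<open>\<S> = {}\<close> this is the trivial cover \<open>{X}\<close>.\<close>

definition common_refinement :: "'a set \<Rightarrow> 'a set set set \<Rightarrow> 'a set set" where
  "common_refinement X \<S> = {X \<inter> (\<Inter>\<C>\<in>\<S>. f \<C>) | f. \<forall>\<C>\<in>\<S>. f \<C> \<in> \<C>}"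

definition uniformity_from_subbase :: "'a set \<Rightarrow> 'a set set set \<Rightarrow> 'a set set set" where
  "uniformity_from_subbase X \<S> =
     {\<C> \<in> covers_of X. \<exists>\<F>\<subseteq>\<S>. finite \<F> \<and> refines (common_refinement X \<F>) \<C>}"

definition cover_star :: "'a set set \<Rightarrow> 'a \<Rightarrow> 'a set" where
  "cover_star \<C> x = \<Union>{A \<in> \<C>. x \<in> A}"

definition uniform_topology :: "'a set \<Rightarrow> 'a set set set \<Rightarrow> 'a topology" where
  "uniform_topology X \<U> =
     topology (\<lambda>W. W \<subseteq> X \<and> (\<forall>x\<in>W. \<exists>\<C>\<in>\<U>. cover_star \<C> x \<subseteq> W))"

lemma openin_uniform_topology:
  assumes meet: "\<And>\<C> \<D>. \<lbrakk>\<C> \<in> \<U>; \<D> \<in> \<U>\<rbrakk> \<Longrightarrow> {A \<inter> B | A B. A \<in> \<C> \<and> B \<in> \<D>} \<in> \<U>"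
  shows "openin (uniform_topology X \<U>) W \<longleftrightarrow>
     W \<subseteq> X \<and> (\<forall>x\<in>W. \<exists>\<C>\<in>\<U>. cover_star \<C> x \<subseteq> W)"
proof -
  have "istopology (\<lambda>W. W \<subseteq> X \<and> (\<forall>x\<in>W. \<exists>\<C>\<in>\<U>. cover_star \<C> x \<subseteq> W))" (is "istopology ?P")
    unfolding istopology_def
  proof (intro conjI allI impI)
    fix S T assume S: "?P S" and T: "?P T"
    show "S \<inter> T \<subseteq> X" using S by blast
    show "\<forall>x\<in>S \<inter> T. \<exists>\<C>\<in>\<U>. cover_star \<C> x \<subseteq> S \<inter> T"
    proof
      fix x assume "x \<in> S \<inter> T"
      then obtain \<C> \<D> where C: "\<C> \<in> \<U>" "cover_star \<C> x \<subseteq> S"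
        and D: "\<D> \<in> \<U>" "cover_star \<D> x \<subseteq> T"
        using S T by blast
      have "cover_star {A \<inter> B | A B. A \<in> \<C> \<and> B \<in> \<D>} x \<subseteq> S \<inter> T"
        using C(2) D(2) unfolding cover_star_def by blast
      then show "\<exists>\<C>\<in>\<U>. cover_star \<C> x \<subseteq> S \<inter> T"
        using meet[OF C(1) D(1)] by blast
    qed
  next
    fix K assume "\<forall>S\<in>K. ?P S"
    then show "\<Union>K \<subseteq> X" and "\<forall>x\<in>\<Union>K. \<exists>\<C>\<in>\<U>. cover_star \<C> x \<subseteq> \<Union>K"
      by (blast, fast)
  qed
  then show ?thesis
    by (simp add: uniform_topology_def topology_inverse')
qed


section \<open>Hausdorff completion of a covering uniformity\<close>

text \<open>The completion is realised on the set of minimal Cauchy filters.  In the order on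
  the type of filters, \<open>F \<le> G\<close> says that \<open>F\<close> contains at least the sets of \<open>G\<close>; a minimal
  Cauchy filter, i.e. one with as few sets as possible, is therefore a maximal element.\<close>

definition cauchy_filter_on :: "'a set \<Rightarrow> 'a set set set \<Rightarrow> 'a filter \<Rightarrow> bool" where
  "cauchy_filter_on X \<U> F \<longleftrightarrow> F \<noteq> bot \<and> F \<le> principal X \<and>
     (\<forall>\<C>\<in>\<U>. \<exists>A\<in>\<C>. eventually (\<lambda>x. x \<in> A) F)"

definition completion_carrier :: "'a set \<Rightarrow> 'a set set set \<Rightarrow> 'a filter set" where
  "completion_carrier X \<U> =
     {F. cauchy_filter_on X \<U> F \<and> (\<forall>G. cauchy_filter_on X \<U> G \<and> F \<le> G \<longrightarrow> G = F)}"

definition completion_extend :: "'a set \<Rightarrow> 'a set set set \<Rightarrow> 'a set \<Rightarrow> 'a filter set" where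
  "completion_extend X \<U> A = {F \<in> completion_carrier X \<U>. eventually (\<lambda>x. x \<in> A) F}"

definition completion_uniformity :: "'a set \<Rightarrow> 'a set set set \<Rightarrow> 'a filter set set set" where
  "completion_uniformity X \<U> =
     {\<D> \<in> covers_of (completion_carrier X \<U>). \<exists>\<C>\<in>\<U>. refines (completion_extend X \<U> ` \<C>) \<D>}"

definition completion_topology :: "'a set \<Rightarrow> 'a set set set \<Rightarrow> 'a filter topology" where
  "completion_topology X \<U> =
     uniform_topology (completion_carrier X \<U>) (completion_uniformity X \<U>)"

definition completion_map :: "'a set \<Rightarrow> 'a set set set \<Rightarrow> 'a \<Rightarrow> 'a filter" where
  "completion_map X \<U> x = nhdsin (uniform_topology X \<U>) x"


section \<open>The median uniformity and the minimal median compactification\<close>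

definition median_uniformity :: "'a set \<Rightarrow> ('a \<Rightarrow> 'a \<Rightarrow> 'a \<Rightarrow> 'a) \<Rightarrow> 'a set set set" where
  "median_uniformity X m =
     uniformity_from_subbase X {{branch X m u v, branch X m v u} | u v. (u, v) \<in> chain_pairs X m}"

definition median_topology :: "'a set \<Rightarrow> ('a \<Rightarrow> 'a \<Rightarrow> 'a \<Rightarrow> 'a) \<Rightarrow> 'a topology" where
  "median_topology X m = uniform_topology X (median_uniformity X m)"

definition mmc_space :: "'a set \<Rightarrow> ('a \<Rightarrow> 'a \<Rightarrow> 'a \<Rightarrow> 'a) \<Rightarrow> 'a filter topology" where
  "mmc_space X m = completion_topology X (median_uniformity X m)"

definition mmc_map :: "'a set \<Rightarrow> ('a \<Rightarrow> 'a \<Rightarrow> 'a \<Rightarrow> 'a) \<Rightarrow> 'a \<Rightarrow> 'a filter" where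
  "mmc_map X m = completion_map X (median_uniformity X m)"

text \<open>The unique continuous extension of \<open>m\<close>.  Extensionality only fixes irrelevant
  values off the carrier, so that the description is of a single function.\<close>

definition mmc_median ::
  "'a set \<Rightarrow> ('a \<Rightarrow> 'a \<Rightarrow> 'a \<Rightarrow> 'a) \<Rightarrow> 'a filter \<Rightarrow> 'a filter \<Rightarrow> 'a filter \<Rightarrow> 'a filter" where
  "mmc_median X m F G H =
     (let K = mmc_space X m; K3 = prod_topology K (prod_topology K K); j = mmc_map X m in
       (THE g. g \<in> extensional (topspace K3) \<and> continuous_map K3 K g \<and>
          (\<forall>x\<in>X. \<forall>y\<in>X. \<forall>z\<in>X. g (j x, j y, j z) = j (m x y z))) (F, G, H))"


section \<open>The Roller--Fioravanti compactification\<close>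

definition rf_map :: "'a set \<Rightarrow> ('a \<Rightarrow> 'a \<Rightarrow> 'a \<Rightarrow> 'a) \<Rightarrow> 'a \<Rightarrow> 'a \<times> 'a \<Rightarrow> 'a" where
  "rf_map X m x = (\<lambda>(u, v) \<in> X \<times> X. median_retraction m u v x)"

definition rf_product :: "'a topology \<Rightarrow> ('a \<Rightarrow> 'a \<Rightarrow> 'a \<Rightarrow> 'a) \<Rightarrow> ('a \<times> 'a \<Rightarrow> 'a) topology" where
  "rf_product \<sigma> m =
     product_topology (\<lambda>(u, v). subtopology \<sigma> (median_interval (topspace \<sigma>) m u v))
       (topspace \<sigma> \<times> topspace \<sigma>)"

definition rf_space :: "'a topology \<Rightarrow> ('a \<Rightarrow> 'a \<Rightarrow> 'a \<Rightarrow> 'a) \<Rightarrow> ('a \<times> 'a \<Rightarrow> 'a) topology" where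
  "rf_space \<sigma> m = subtopology (rf_product \<sigma> m)
     (rf_product \<sigma> m closure_of (rf_map (topspace \<sigma>) m ` topspace \<sigma>))"

definition rf_median ::
  "'a set \<Rightarrow> ('a \<Rightarrow> 'a \<Rightarrow> 'a \<Rightarrow> 'a) \<Rightarrow>
     ('a \<times> 'a \<Rightarrow> 'a) \<Rightarrow> ('a \<times> 'a \<Rightarrow> 'a) \<Rightarrow> ('a \<times> 'a \<Rightarrow> 'a) \<Rightarrow> 'a \<times> 'a \<Rightarrow> 'a" where
  "rf_median X m f g h = (\<lambda>p \<in> X \<times> X. m (f p) (g p) (h p))"


section \<open>Compactifications\<close>

text \<open>\<open>j\<close> need not be a topological embedding.\<close>

definition median_compactification ::
  "'a topology \<Rightarrow> ('a \<Rightarrow> 'a \<Rightarrow> 'a \<Rightarrow> 'a) \<Rightarrow>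
     'b topology \<Rightarrow> ('b \<Rightarrow> 'b \<Rightarrow> 'b \<Rightarrow> 'b) \<Rightarrow> ('a \<Rightarrow> 'b) \<Rightarrow> bool" where
  "median_compactification T m K mK j \<longleftrightarrow>
     topological_median_algebra K mK \<and> compact_space K \<and>
     continuous_map T K j \<and> K closure_of (j ` topspace T) = topspace K \<and>
     (\<forall>x\<in>topspace T. \<forall>y\<in>topspace T. \<forall>z\<in>topspace T. j (m x y z) = mK (j x) (j y) (j z))"

definition compactification_iso ::
  "'a set \<Rightarrow> 'b topology \<Rightarrow> ('b \<Rightarrow> 'b \<Rightarrow> 'b \<Rightarrow> 'b) \<Rightarrow> ('a \<Rightarrow> 'b) \<Rightarrow>
     'c topology \<Rightarrow> ('c \<Rightarrow> 'c \<Rightarrow> 'c \<Rightarrow> 'c) \<Rightarrow> ('a \<Rightarrow> 'c) \<Rightarrow> ('b \<Rightarrow> 'c) \<Rightarrow> bool" where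
  "compactification_iso X K mK j L mL i h \<longleftrightarrow>
     homeomorphic_map K L h \<and>
     (\<forall>a\<in>topspace K. \<forall>b\<in>topspace K. \<forall>c\<in>topspace K. h (mK a b c) = mL (h a) (h b) (h c)) \<and>
     (\<forall>x\<in>X. h (j x) = i x)"

end

theory Submission
  imports Defs
begin

text \<open>
  Write \<open>\<phi>\<^sub>u\<^sub>v x = m u x v\<close> for the retraction onto the interval \<open>[u, v]\<close>, and \<open>R\<close> for the
  closure of the image of \<open>\<nu>\<close> in the product of the intervals.  The compact Hausdorff space \<open>R\<close>
  carries a single uniformity, so the point is that this uniformity restricts along \<open>\<nu>\<close> to the
  median uniformity of \<open>X\<close>; a compact space in which \<open>X\<close> is dense and which induces a given
  uniformity is its completion.  Two properties of \<open>\<nu>\<close> express that the uniformities agree.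

  First, the median uniformity is coarse enough: for a chain interval \<open>[u, v]\<close> a point of \<open>R\<close> has
  a \<open>(u, v)\<close> coordinate different from \<open>u\<close> or from \<open>v\<close>, and this persists nearby, so near every
  point of \<open>R\<close> one of the two branches contains all nearby points of \<open>X\<close>.

  Second, it is fine enough: distinct points of \<open>R\<close> have neighbourhoods such that no member of a
  suitable uniform cover meets the traces of both on \<open>X\<close>.  Two such points differ in some
  coordinate \<open>(u, v)\<close>, with values \<open>p \<noteq> q\<close> in \<open>[u, v]\<close>.  By the hypothesis \<open>T2m\<close> some chain
  interval separates \<open>p\<close> from \<open>q\<close>, and \<open>separating_branches\<close> shrinks it to a chain interval
  \<open>[c, d]\<close> such that \<open>\<phi>\<^sub>c\<^sub>d = c\<close> on an open set around \<open>p\<close> and \<open>\<phi>\<^sub>c\<^sub>d = d\<close> on an open set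
  around \<open>q\<close>.  Since \<open>p\<close> and \<open>q\<close> belong to \<open>[u, v]\<close> and go to the two ends of \<open>[c, d]\<close>, so do
  \<open>u\<close> and \<open>v\<close>; hence the retraction \<open>\<phi>\<^sub>c\<^sub>d\<close> factors through \<open>\<phi>\<^sub>u\<^sub>v\<close>
  (\<open>separating_chain_in_interval\<close>), and the cover by the two branches of \<open>[c, d]\<close> does the job.

  The algebra behind this is that retractions are median homomorphisms (\<open>retraction_hom\<close>), which
  is derived here from the associative law by way of the gate property (\<open>gate\<close>).  The topology is
  in the locale \<open>cover_compactification\<close>: given the two properties, sending a point of \<open>R\<close> to the
  trace of its neighbourhood filter on \<open>X\<close> is a homeomorphism onto the completion, and the topology
  that \<open>R\<close> induces on \<open>X\<close> is the uniform one.  The median of the completion is then the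
  transported median of \<open>R\<close>, because a continuous extension from a dense subset is unique; the same
  density makes the isomorphism unique.
\<close>

section \<open>Betweenness and retractions in a median algebra\<close>

context median_algebra
begin

text \<open>
  Membership of \<open>b\<close> in \<open>[a, c]\<close>, bundled with membership of all three points in \<open>X\<close>, so
  that the calculus of betweenness below runs without side conditions.  For fixed \<open>a\<close> the relation
  \<open>between a b c\<close> is the order \<open>b \<le> c\<close> of the meet semilattice based at \<open>a\<close>, whose meet is
  \<open>m a b c\<close>.
\<close>

definition between :: "'a \<Rightarrow> 'a \<Rightarrow> 'a \<Rightarrow> bool" where
  "between a b c \<longleftrightarrow> a \<in> X \<and> b \<in> X \<and> c \<in> X \<and> m a b c = b"

lemma median_swap13: "\<lbrakk>a \<in> X; b \<in> X; c \<in> X\<rbrakk> \<Longrightarrow> m a b c = m c b a"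
  using median_swap12 median_swap23 by metis

text \<open>
  Associativity of the meet \<open>m a\<close> of the semilattice based at \<open>a\<close>.
\<close>

lemma median_assoc_left:
  "\<lbrakk>a \<in> X; b \<in> X; c \<in> X; d \<in> X\<rbrakk> \<Longrightarrow> m a (m a b c) d = m a b (m a c d)"
  using median_assoc[of b c d a] median_swap12 median_closed by metis

lemma betweenD: "between a b c \<Longrightarrow> a \<in> X" "between a b c \<Longrightarrow> b \<in> X" "between a b c \<Longrightarrow> c \<in> X" "between a b c \<Longrightarrow> m a b c = b"
  by (auto simp: between_def)

lemma between_sym: "between a b c \<Longrightarrow> between c b a"
  unfolding between_def using median_swap13 by metis

lemma between_ends: "\<lbrakk>a \<in> X; b \<in> X\<rbrakk> \<Longrightarrow> between a a b \<and> between a b b"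
  unfolding between_def using median_absorb median_swap13 by metis

lemma between_antisym: "\<lbrakk>between a b c; between a c b\<rbrakk> \<Longrightarrow> b = c"
  unfolding between_def using median_swap23 by metis

lemma between_trans: "\<lbrakk>between a b c; between a c d\<rbrakk> \<Longrightarrow> between a b d"
  unfolding between_def using median_assoc_left by metis

text \<open>
  If \<open>b \<le> c \<le> d\<close> as seen from \<open>a\<close>, the four points lie in this order; so seen from \<open>d\<close>
  the points come in the reverse order.
\<close>

lemma between_shift:
  assumes "between a b c" "between a c d"
  shows "between b c d"
proof -
  have X: "a \<in> X" "b \<in> X" "c \<in> X" "d \<in> X" using assms by (auto simp: between_def)
  have "m b c d = m (m b c a) c d"
    using assms X unfolding between_def by (metis median_swap12 median_swap23)
  also have "\<dots> = m b c (m a c d)" using X median_assoc by metis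
  also have "\<dots> = c" using assms X median_absorb unfolding between_def by metis
  finally show ?thesis using X by (simp add: between_def)
qed

lemma between_median1: "\<lbrakk>a \<in> X; b \<in> X; c \<in> X\<rbrakk> \<Longrightarrow> between a (m a b c) b"
  unfolding between_def by (metis median_absorb median_assoc_left median_closed median_swap23)

lemma between_median:
  assumes "a \<in> X" "b \<in> X" "c \<in> X"
  shows "between a (m a b c) b" "between b (m a b c) c" "between a (m a b c) c"
  using between_median1[of a b c] between_median1[of b c a] between_median1[of a c b] assms
    median_swap12 median_swap23 by (metis)+

lemma between_meet: "\<lbrakk>between a z b; between a z c\<rbrakk> \<Longrightarrow> between a z (m a b c)"
  unfolding between_def by (metis median_assoc_left median_closed)

text \<open>
  As seen from \<open>a\<close>, the point \<open>z\<close> is below the median and the median is below \<open>b\<close>; turning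
  this round, the median is below \<open>z\<close> as seen from \<open>b\<close>.  But \<open>z\<close> is also below the median as
  seen from \<open>b\<close>, so antisymmetry applies.
\<close>

lemma median_unique:
  assumes "between a z b" "between b z c" "between a z c"
  shows "z = m a b c"
proof -
  have X: "a \<in> X" "b \<in> X" "c \<in> X" "z \<in> X" using assms by (auto simp: between_def)
  have "between a z (m a b c)" using assms by (intro between_meet)
  then have 1: "between z (m a b c) b" using between_median(1)[OF X(1-3)] between_shift by blast
  have "m b a c = m a b c" using X median_swap12 by metis
  then have "between b z (m a b c)" using between_meet[OF between_sym[OF assms(1)] assms(2)] by simp
  with 1 show ?thesis by (metis between_antisym between_sym)
qed

text \<open>
  The median \<open>m a b z\<close> is the gate of \<open>z\<close> in \<open>[a, b]\<close>: it lies on the way from \<open>z\<close> to every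
  point \<open>x\<close> of the interval.  Seen from \<open>a\<close>, the meet of \<open>x\<close> with \<open>z\<close> equals its meet with
  \<open>m a b z\<close> because \<open>x\<close> is below \<open>b\<close>; hence it is below the gate, which is below \<open>z\<close>.  Seen
  from \<open>z\<close> the order is reversed, and this meet is in turn below \<open>x\<close>.
\<close>

lemma gate:
  assumes "between a x b" "z \<in> X"
  shows "between z (m a b z) x"
proof -
  have X: "a \<in> X" "b \<in> X" "x \<in> X" using assms by (auto simp: between_def)
  have "m a x z = m a x (m a b z)"
    using assms X by (metis between_def median_assoc_left)
  then have "between a (m a x z) (m a b z)"
    using between_median(3)[of a x "m a b z"] X assms median_closed by metis
  then have "between (m a x z) (m a b z) z"
    using between_median(3)[of a b z] X assms between_shift by blast
  moreover have "between z (m a x z) x"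
    using between_median(2)[of a x z] X assms between_sym by blast
  ultimately show ?thesis using between_sym between_trans by blast
qed

text \<open>
  Intervals are convex: the gate of \<open>z\<close> in \<open>[a, b]\<close> lies towards both \<open>x\<close> and \<open>y\<close>, but
  \<open>z\<close> is between these two, so \<open>z\<close> is its own gate.
\<close>

lemma between_convex:
  assumes "between a x b" "between a y b" "between x z y"
  shows "between a z b"
proof -
  have X: "a \<in> X" "b \<in> X" "x \<in> X" "y \<in> X" "z \<in> X" using assms by (auto simp: between_def)
  have "between z (m a b z) (m z x y)"
    using between_meet gate assms X by blast
  moreover have "m z x y = z" using assms(3) X median_swap12 by (metis between_def)
  ultimately have "m a b z = z" using X median_closed
    by (metis between_antisym between_ends)
  then show ?thesis using between_median(3)[of a b z] between_median(1)[of a b z] X by metis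
qed

lemma interval_closed:
  assumes "between a x b" "between a y b" "between a z b"
  shows "between a (m x y z) b"
proof -
  have "between x (m x y z) y" using assms by (intro between_median) (auto simp: between_def)
  then show ?thesis using between_convex assms by blast
qed

text \<open>
  Let \<open>p\<close>, \<open>q\<close>, \<open>u\<close> be the gates of \<open>x\<close>, \<open>y\<close>, \<open>z\<close> in \<open>[a, b]\<close> and \<open>g\<close> the median of
  the three gates.  The point \<open>u\<close> lies between \<open>z\<close> and \<open>g\<close>, since \<open>g\<close> is in \<open>[a, b]\<close>.  On the
  other hand, seen from \<open>u\<close>, the point \<open>g\<close> is below \<open>x\<close> and \<open>y\<close>, hence below their meet, which is
  the gate of \<open>u\<close> in \<open>[x, y]\<close> and so lies towards \<open>z\<close>.  The two facts force \<open>g = u\<close>.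
\<close>

lemma retraction_between:
  assumes "between x z y" "a \<in> X" "b \<in> X"
  shows "between (m a x b) (m a z b) (m a y b)"
proof -
  have X: "x \<in> X" "y \<in> X" "z \<in> X" using assms by (auto simp: between_def)
  define p q u where "p = m a x b" and "q = m a y b" and "u = m a z b"
  have in_ab: "between a p b" "between a q b" "between a u b"
    unfolding p_def q_def u_def using between_median(3) X assms by blast+
  have gate': "between t (m a t b) w" if "between a w b" "t \<in> X" for t w
    using gate[OF that] median_swap23 that assms by metis
  define g where "g = m p q u"
  have pqu: "p \<in> X" "q \<in> X" "u \<in> X" using in_ab by (auto simp: between_def)
  have "between p g q" "between u g p" "between u g q"
    unfolding g_def using between_median[OF pqu] between_sym by blast+
  have "between a g b" using between_convex in_ab \<open>between p g q\<close> by blast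
  then have ug: "between z u g" unfolding u_def using gate' X by blast
  have "between u p x" "between u q y"
    unfolding p_def q_def using gate' X in_ab between_sym by blast+
  then have "between u g x" "between u g y" 
    using \<open>between u g p\<close> \<open>between u g q\<close> between_trans by blast+
  then have "between u g (m u x y)" by (rule between_meet)
  moreover have "between u (m x y u) z" using gate[OF assms(1) pqu(3)] .
  moreover have "m x y u = m u x y" using X pqu median_swap12 median_swap23 by metis
  ultimately have "between u g z" using between_trans by metis
  then have "g = u" using ug between_antisym between_sym by blast
  then show ?thesis using \<open>between p g q\<close> unfolding p_def q_def u_def by simp
qed

text \<open>
  Preservation of betweenness suffices because a median is the only point in the
  three intervals spanned by its arguments.
\<close>

lemma retraction_hom:
  assumes "a \<in> X" "b \<in> X" "x \<in> X" "y \<in> X" "z \<in> X"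
  shows "m a (m x y z) b = m (m a x b) (m a y b) (m a z b)"
  using median_unique retraction_between between_median assms by meson

lemma retraction_retraction:
  assumes "between a c b" "between a d b" "x \<in> X"
  shows "m c (m a x b) d = m c x d"
proof -
  have X: "a \<in> X" "b \<in> X" "c \<in> X" "d \<in> X" using assms by (auto simp: between_def)
  have "m a (m c x d) b = m (m a c b) (m a x b) (m a d b)"
    using X assms by (intro retraction_hom)
  also have "\<dots> = m c (m a x b) d" using assms by (simp add: between_def)
  also have "m a (m c x d) b = m c x d"
    using between_convex[OF assms(1,2) between_median(3)] X assms by (simp add: betweenD)
  finally show ?thesis by simp
qed

section \<open>Chain intervals separate points\<close>

lemma interval_iff_between: "\<lbrakk>a \<in> X; b \<in> X\<rbrakk> \<Longrightarrow> z \<in> median_interval X m a b \<longleftrightarrow> between a z b"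
  unfolding median_interval_def between_def using median_swap23 by auto

text \<open>
  Subintervals are needed because a point \<open>x\<close> with \<open>m u x v\<close> strictly inside a chain interval
  \<open>[u, v]\<close> belongs to both of its branches: such points are told apart only by shorter chains.
\<close>

lemma chain_subinterval:
  assumes "(a, b) \<in> chain_pairs X m" "between a c b" "between a d b" "c \<noteq> d"
  shows "(c, d) \<in> chain_pairs X m"
proof -
  have X: "a \<in> X" "b \<in> X" "c \<in> X" "d \<in> X" using assms by (auto simp: between_def)
  let ?C = "median_interval X m a b" and ?D = "median_interval X m c d"
  have sub: "?D \<subseteq> ?C"
    using between_convex[OF assms(2,3)] X by (simp add: interval_iff_between subset_iff)
  have alg: "median_subalgebra X m ?D"
    unfolding median_subalgebra_def
  proof (intro conjI ballI)
    fix x y z assume "x \<in> ?D" "y \<in> ?D" "z \<in> ?D"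
    then have D: "between c x d" "between c y d" "between c z d" using X by (simp_all add: interval_iff_between)
    then show "m x y z \<in> ?D" using interval_closed[OF D] X by (simp add: interval_iff_between)
  qed (auto simp: median_interval_def)
  obtain r where r: "linear_order_on ?C r"
    "\<forall>a\<in>?C. \<forall>b\<in>?C. \<forall>c\<in>?C. (a, b) \<in> r \<and> (b, c) \<in> r \<longrightarrow> m a b c = b"
    using assms(1) unfolding chain_pairs_def median_chain_def by auto
  have "linear_order_on ?D (Restr r ?D)"
  proof -
    have "refl_on ?C r" "trans r" "antisym r" "total_on ?C r"
      using r(1) by (simp_all add: order_on_defs)
    then have "refl_on ?D (Restr r ?D)" "trans (Restr r ?D)" "antisym (Restr r ?D)"
      "total_on ?D (Restr r ?D)"
      using sub by (simp_all add: refl_on_def trans_Restr antisym_Restr total_on_def subset_iff)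
    then show ?thesis by (simp add: order_on_defs)
  qed
  moreover have "\<forall>a\<in>?D. \<forall>b\<in>?D. \<forall>c\<in>?D. (a, b) \<in> Restr r ?D \<and> (b, c) \<in> Restr r ?D \<longrightarrow> m a b c = b"
    using r(2) sub by (meson IntD1 subsetD)
  ultimately have "median_chain X m ?D"
    unfolding median_chain_def using alg by blast
  then show ?thesis using X assms(4) by (simp add: chain_pairs_def)
qed

lemma chain_pairs_sym: "(a, b) \<in> chain_pairs X m \<Longrightarrow> (b, a) \<in> chain_pairs X m"
proof -
  assume a: "(a, b) \<in> chain_pairs X m"
  then have X: "a \<in> X" "b \<in> X" "a \<noteq> b" unfolding chain_pairs_def by auto
  then show ?thesis using chain_subinterval[OF a, of b a] between_ends by blast
qed

text \<open>
  In the linear order of the chain the end \<open>a\<close> must be extreme: if it had \<open>x\<close> and \<open>y\<close> strictly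
  on its two sides, then it would separate \<open>b\<close> from one of them, whereas both lie between \<open>a\<close> and
  \<open>b\<close>.
\<close>

lemma chain_meet:
  assumes "(a, b) \<in> chain_pairs X m" "between a x b" "between a y b"
  shows "m a x y = x \<or> m a x y = y"
proof -
  have X: "a \<in> X" "b \<in> X" "x \<in> X" "y \<in> X" using assms by (auto simp: between_def)
  let ?C = "median_interval X m a b"
  obtain r where r: "linear_order_on ?C r"
    and med: "\<And>a b c. \<lbrakk>a\<in>?C; b\<in>?C; c\<in>?C; (a, b) \<in> r; (b, c) \<in> r\<rbrakk> \<Longrightarrow> m a b c = b"
    using assms(1) unfolding chain_pairs_def median_chain_def by blast
  have C: "a \<in> ?C" "b \<in> ?C" "x \<in> ?C" "y \<in> ?C"
    using assms X between_ends by (auto simp: interval_iff_between)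
  have tot: "(s, t) \<in> r \<or> (t, s) \<in> r" if "s \<in> ?C" "t \<in> ?C" for s t
  proof -
    have "refl_on ?C r" "total_on ?C r" using r by (simp_all add: order_on_defs)
    then show ?thesis using that by (cases "s = t") (simp_all add: refl_on_def total_on_def)
  qed
  have bx: "m a x b = x" "m a y b = y" using assms by (auto simp: between_def)
  show ?thesis
    using tot[OF C(1) C(2)] tot[OF C(1) C(3)] tot[OF C(1) C(4)] tot[OF C(3) C(4)] med C bx X
    by (metis median_swap12 median_swap23)
qed

lemma chain_pairsD: "(a, b) \<in> chain_pairs X m \<Longrightarrow> a \<in> X \<and> b \<in> X \<and> a \<noteq> b"
  by (auto simp: chain_pairs_def)

text \<open>
  For a point \<open>e\<close> of a chain interval \<open>[a, b]\<close>, the branch at \<open>e\<close> that contains \<open>a\<close> consists of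
  points that retract strictly below \<open>e\<close>.
\<close>

lemma branch_retraction:
  assumes "(a, b) \<in> chain_pairs X m" "between a e b" "x \<in> X" "m a x e \<noteq> e"
  shows "between a (m a x b) e \<and> m a x b \<noteq> e"
proof -
  have X: "a \<in> X" "b \<in> X" "e \<in> X" using assms by (auto simp: between_def)
  let ?y = "m a x b"
  have y: "between a ?y b" using between_median(3) X assms(3) by blast
  have "m a ?y e = m a x e"
    using retraction_retraction[of a a b e x] between_ends X assms by blast
  then have ne: "m a ?y e \<noteq> e" using assms by simp
  then have "m a ?y e = ?y" using chain_meet[OF assms(1) y assms(2)] by blast
  then show ?thesis using ne X y by (simp add: between_def)
qed

text \<open>
  A cover by two overlapping branches separates points only if their retractions are opposite
  ends of the chain, and for two points this has to hold on whole neighbourhoods.  Start from a chain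
  interval \<open>[a, b]\<close> to whose ends \<open>p\<close> and \<open>q\<close> retract.  If it has two interior points, these can
  serve as \<open>c\<close> and \<open>d\<close>: the open branches beyond them retract to \<open>c\<close> and \<open>d\<close>.  With at most one
  interior point, a branch that stops short of that point, or of the opposite end, retracts to a
  single end, and the chain itself works.
\<close>

lemma separating_branches:
  assumes "T2m X m" "p \<in> X" "q \<in> X" "p \<noteq> q"
  obtains a e b f c d where "a \<in> X" "e \<in> X" "b \<in> X" "f \<in> X" "(c, d) \<in> chain_pairs X m"
    "p \<in> branch X m a e" "q \<in> branch X m b f"
    "\<And>x. x \<in> branch X m a e \<Longrightarrow> m c x d = c"
    "\<And>x. x \<in> branch X m b f \<Longrightarrow> m c x d = d"
proof -
  obtain a0 b0 where ab0: "(a0, b0) \<in> chain_pairs X m" "{m a0 p b0, m a0 q b0} = {a0, b0}"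
    using assms unfolding T2m_def median_retraction_def by blast
  obtain a b where ab: "(a, b) \<in> chain_pairs X m" "m a p b = a" "m a q b = b"
  proof (cases "m a0 p b0 = a0")
    case True
    then show ?thesis using ab0 chain_pairsD[OF ab0(1)] that by (metis doubleton_eq_iff)
  next
    case False
    then have "m a0 p b0 = b0" "m a0 q b0 = a0" using ab0(2) by (metis doubleton_eq_iff)+
    then show ?thesis
      using that[OF chain_pairs_sym[OF ab0(1)]] chain_pairsD[OF ab0(1)] median_swap13 assms by metis
  qed
  have ba: "(b, a) \<in> chain_pairs X m" using ab chain_pairs_sym by blast
  have X: "a \<in> X" "b \<in> X" "a \<noteq> b" using ab chain_pairsD by blast+
  have p_branch: "p \<in> branch X m a e" if "between a e b" "e \<noteq> a" for e
  proof -
    have "m a p e = m a (m a p b) e"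
      using retraction_retraction[of a a b e p] that between_ends X assms by simp
    then show ?thesis using that ab(2) X assms by (auto simp: branch_def between_ends betweenD)
  qed
  have q_branch: "q \<in> branch X m b f" if "between a f b" "f \<noteq> b" for f
  proof -
    have "m b q f = m b (m b q a) f"
      using retraction_retraction[of b b a f q] that between_ends between_sym X assms by simp
    moreover have "m b q a = b" using ab(3) X assms median_swap13 by metis
    ultimately show ?thesis using that X assms by (auto simp: branch_def between_ends betweenD)
  qed
  have left: "between a (m a x b) e \<and> m a x b \<noteq> e" if "between a e b" "x \<in> branch X m a e" for e x
    using branch_retraction[OF ab(1) that(1)] that(2) by (simp add: branch_def)
  have right: "between b (m a x b) f \<and> m a x b \<noteq> f" if "between a f b" "x \<in> branch X m b f" for f x
    using branch_retraction[OF ba between_sym[OF that(1)]] that(2) median_swap13[of a x b] X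
    by (simp add: branch_def)
  have in_X: "x \<in> X" if "x \<in> branch X m s t" for x s t using that by (simp add: branch_def)
  have in_ab: "between a (m a x b) b" if "x \<in> X" for x using between_median(3) X that by blast
  show ?thesis
  proof (cases "\<exists>w1 w2. between a w1 b \<and> between a w2 b \<and> w1 \<notin> {a, b} \<and> w2 \<notin> {a, b} \<and> w1 \<noteq> w2")
    case True
    then obtain c d where cd: "between a c b" "between a d b" "c \<notin> {a, b}" "d \<notin> {a, b}" "c \<noteq> d"
      "between a c d"
      using chain_meet[OF ab(1)] median_swap23 X unfolding between_def by metis
    have X': "c \<in> X" "d \<in> X" using cd by (auto simp: between_def)
    have "between b d c" using between_shift[OF cd(6,2)] between_sym by blast
    have red: "m c (m a x b) d = m c x d" if "x \<in> X" for x
      using retraction_retraction[OF cd(1,2) that] .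
    \<comment> \<open>two interior points: the branches at \<open>c\<close> and \<open>d\<close> are the sides of the chain below \<open>c\<close> and above \<open>d\<close>\<close>
    show ?thesis
    proof (rule that[of a c b d c d])
      show "(c, d) \<in> chain_pairs X m" using chain_subinterval ab cd by blast
      show "p \<in> branch X m a c" "q \<in> branch X m b d" using p_branch q_branch cd by blast+
      show "m c x d = c" if x: "x \<in> branch X m a c" for x
      proof -
        have "between (m a x b) c d" using left[OF cd(1) x] cd(6) between_shift by blast
        then show ?thesis
          using red[OF in_X[OF x]] median_swap12 by (metis between_def)
      qed
      show "m c x d = d" if x: "x \<in> branch X m b d" for x
      proof -
        have "between (m a x b) d c" using right[OF cd(2) x] \<open>between b d c\<close> between_shift by blast
        then show ?thesis
          using red[OF in_X[OF x]] median_swap12 median_swap23 by (metis between_def)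
      qed
    qed (use X X' in auto)
  next
    case few: False
    show ?thesis
    proof (cases "\<exists>w. between a w b \<and> w \<notin> {a, b}")
      case True
      then obtain w where w: "between a w b" "w \<notin> {a, b}" by blast
      then have only: "y \<in> {a, w, b}" if "between a y b" for y using few that by blast
      \<comment> \<open>one interior point: below \<open>w\<close> there is only \<open>a\<close>, and above it only \<open>b\<close>\<close>
      show ?thesis
      proof (rule that[of a w b w a b])
        show "p \<in> branch X m a w" "q \<in> branch X m b w" using p_branch q_branch w by blast+
        show "m a x b = a" if "x \<in> branch X m a w" for x
          using left[OF w(1) that] only[OF in_ab[OF in_X[OF that]]] w between_antisym[of a b w] by auto
        show "m a x b = b" if "x \<in> branch X m b w" for x
          using right[OF w(1) that] only[OF in_ab[OF in_X[OF that]]] w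
            between_antisym[of b a w] between_sym[OF w(1)] by auto
      qed (use X ab w betweenD in auto)
    next
      case False
      then have only: "y \<in> {a, b}" if "between a y b" for y using that by blast
      have ends: "between a a b" "between a b b" using between_ends X by blast+
      \<comment> \<open>no interior point: each branch of \<open>[a, b]\<close> retracts to a single end\<close>
      show ?thesis
      proof (rule that[of a b b a a b])
        show "p \<in> branch X m a b" "q \<in> branch X m b a" using p_branch q_branch ends X by blast+
        show "m a x b = a" if "x \<in> branch X m a b" for x
          using left[OF ends(2) that] only[OF in_ab[OF in_X[OF that]]] by blast
        show "m a x b = b" if "x \<in> branch X m b a" for x
          using right[OF ends(1) that] only[OF in_ab[OF in_X[OF that]]] by blast
      qed (use X ab in auto)
    qed
  qed
qed

text \<open>
  The median homomorphism \<open>m c _ d\<close> maps \<open>[u, v]\<close> into the interval between the images of \<open>u\<close>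
  and \<open>v\<close>.  As \<open>p\<close> and \<open>q\<close> go to the ends of the chain, \<open>u\<close> and \<open>v\<close> must go to
  these ends as well, which makes the retraction to \<open>[u, v]\<close> invisible in \<open>[c, d]\<close>.
\<close>

lemma separating_chain_in_interval:
  assumes cd: "(c, d) \<in> chain_pairs X m" and pq: "between u p v" "between u q v"
    and "m c p d = c" "m c q d = d" "x \<in> X"
  shows "m c (m u x v) d = m c x d"
proof -
  have X: "c \<in> X" "d \<in> X" "c \<noteq> d" "u \<in> X" "v \<in> X" "p \<in> X" "q \<in> X"
    using assms chain_pairsD by (auto simp: between_def)
  define s t where "s = m c u d" and "t = m c v d"
  have st: "between c s d" "between c t d" unfolding s_def t_def using between_median(3) X by blast+
  have "between s c t" "between s d t"
    using retraction_between[OF pq(1) X(1,2)] retraction_between[OF pq(2) X(1,2)] assms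
    unfolding s_def t_def by simp_all
  have "m c s t = c" using \<open>between s c t\<close> median_swap12 by (metis between_def)
  then have 1: "s = c \<or> t = c" using chain_meet[OF cd st] by metis
  have "m d s t = d" using \<open>between s d t\<close> median_swap12 by (metis between_def)
  then have 2: "s = d \<or> t = d"
    using chain_meet[OF chain_pairs_sym[OF cd] between_sym[OF st(1)] between_sym[OF st(2)]] by metis
  have "m c (m u x v) d = m s (m c x d) t"
    unfolding s_def t_def using retraction_hom X assms by blast
  moreover have "between c (m c x d) d" using between_median(3) X assms by blast
  ultimately show ?thesis using 1 2 X between_sym betweenD(4) by metis
qed

end

section \<open>Covering uniformities generated by a subbase\<close>

definition cover_meet :: "'a set set \<Rightarrow> 'a set set \<Rightarrow> 'a set set" where
  "cover_meet \<C> \<D> = {A \<inter> B | A B. A \<in> \<C> \<and> B \<in> \<D>}"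

lemma cover_meetI: "\<lbrakk>A \<in> \<C>; B \<in> \<D>\<rbrakk> \<Longrightarrow> A \<inter> B \<in> cover_meet \<C> \<D>"
  by (auto simp: cover_meet_def)

lemma cover_meetE:
  assumes "E \<in> cover_meet \<C> \<D>"
  obtains A B where "A \<in> \<C>" "B \<in> \<D>" "E = A \<inter> B"
  using assms by (auto simp: cover_meet_def)

lemma cover_meet_covers_of:
  assumes "\<C> \<in> covers_of X" "\<D> \<in> covers_of X"
  shows "cover_meet \<C> \<D> \<in> covers_of X"
proof -
  have "\<exists>E\<in>cover_meet \<C> \<D>. x \<in> E" if x: "x \<in> X" for x
  proof -
    obtain A B where "A \<in> \<C>" "x \<in> A" "B \<in> \<D>" "x \<in> B"
      using assms x unfolding covers_of_def by blast
    then show ?thesis using cover_meetI[of A \<C> B \<D>] by (intro bexI[of _ "A \<inter> B"]) simp_all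
  qed
  moreover have "E \<subseteq> X" if "E \<in> cover_meet \<C> \<D>" for E
    using assms(1) that by (auto simp: covers_of_def elim!: cover_meetE)
  ultimately show ?thesis by (auto simp: covers_of_def)
qed

lemma trivial_cover_in_uniformity: "{X} \<in> uniformity_from_subbase X \<S>"
  unfolding uniformity_from_subbase_def
  by (auto simp: covers_of_def common_refinement_def refines_def intro!: exI[of _ "{}"])

lemma subbase_cover_in_uniformity:
  assumes "\<C> \<in> \<S>" "\<C> \<in> covers_of X"
  shows "\<C> \<in> uniformity_from_subbase X \<S>"
proof -
  have "refines (common_refinement X {\<C>}) \<C>"
    unfolding refines_def common_refinement_def by auto
  then show ?thesis
    using assms unfolding uniformity_from_subbase_def by (auto intro!: exI[of _ "{\<C>}"])
qed

lemma common_refinement_restrict: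
  assumes "\<F> \<subseteq> \<G>" "E \<in> common_refinement X \<G>"
  shows "\<exists>E'\<in>common_refinement X \<F>. E \<subseteq> E'"
proof -
  obtain f where f: "E = X \<inter> (\<Inter>\<C>\<in>\<G>. f \<C>)" "\<forall>\<C>\<in>\<G>. f \<C> \<in> \<C>"
    using assms(2) unfolding common_refinement_def by blast
  have "X \<inter> (\<Inter>\<C>\<in>\<F>. f \<C>) \<in> common_refinement X \<F>"
    using f(2) assms(1) unfolding common_refinement_def by blast
  moreover have "E \<subseteq> X \<inter> (\<Inter>\<C>\<in>\<F>. f \<C>)" using f(1) assms(1) by blast
  ultimately show ?thesis by blast
qed

lemma cover_meet_in_uniformity:
  assumes "\<C> \<in> uniformity_from_subbase X \<S>" "\<D> \<in> uniformity_from_subbase X \<S>"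
  shows "cover_meet \<C> \<D> \<in> uniformity_from_subbase X \<S>"
proof -
  obtain \<F> \<G> where F: "\<F> \<subseteq> \<S>" "finite \<F>" "refines (common_refinement X \<F>) \<C>"
    and G: "\<G> \<subseteq> \<S>" "finite \<G>" "refines (common_refinement X \<G>) \<D>"
    using assms unfolding uniformity_from_subbase_def by auto
  have "refines (common_refinement X (\<F> \<union> \<G>)) (cover_meet \<C> \<D>)"
    unfolding refines_def
  proof
    fix E assume E: "E \<in> common_refinement X (\<F> \<union> \<G>)"
    obtain E1 where E1: "E1 \<in> common_refinement X \<F>" "E \<subseteq> E1"
      using common_refinement_restrict[OF _ E, of \<F>] by auto
    obtain E2 where E2: "E2 \<in> common_refinement X \<G>" "E \<subseteq> E2"
      using common_refinement_restrict[OF _ E, of \<G>] by auto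
    obtain A where A: "A \<in> \<C>" "E1 \<subseteq> A" using F(3) E1(1) unfolding refines_def by auto
    obtain B where B: "B \<in> \<D>" "E2 \<subseteq> B" using G(3) E2(1) unfolding refines_def by auto
    have "E \<subseteq> A \<inter> B" using E1 E2 A B by auto
    then show "\<exists>C\<in>cover_meet \<C> \<D>. E \<subseteq> C" using cover_meetI[OF A(1) B(1)] by (intro bexI)
  qed
  moreover have "cover_meet \<C> \<D> \<in> covers_of X"
    using assms by (intro cover_meet_covers_of) (simp_all add: uniformity_from_subbase_def)
  moreover have "\<F> \<union> \<G> \<subseteq> \<S>" "finite (\<F> \<union> \<G>)" using F G by auto
  ultimately show ?thesis
    unfolding uniformity_from_subbase_def by blast
qed

text \<open>
  A condition on a fixed point \<open>k\<close> that holds for the subbasic covers passes to all uniform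
  covers, by intersecting the finitely many neighbourhoods involved.
\<close>

lemma neighbourhood_in_uniform_cover:
  assumes subbase: "\<And>\<C>. \<C> \<in> \<S> \<Longrightarrow>
      \<exists>A\<in>\<C>. \<exists>N. openin K N \<and> k \<in> N \<and> (\<forall>x\<in>X. j x \<in> N \<longrightarrow> x \<in> A)"
    and maps: "\<And>x. x \<in> X \<Longrightarrow> j x \<in> topspace K" and k: "k \<in> topspace K"
    and C: "\<C> \<in> uniformity_from_subbase X \<S>"
  shows "\<exists>A\<in>\<C>. \<exists>N. openin K N \<and> k \<in> N \<and> (\<forall>x\<in>X. j x \<in> N \<longrightarrow> x \<in> A)"
proof -
  obtain \<F> where F: "\<F> \<subseteq> \<S>" "finite \<F>" "refines (common_refinement X \<F>) \<C>"
    using C unfolding uniformity_from_subbase_def by auto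
  have "\<forall>\<D>\<in>\<F>. \<exists>A N. A \<in> \<D> \<and> openin K N \<and> k \<in> N \<and> (\<forall>x\<in>X. j x \<in> N \<longrightarrow> x \<in> A)"
    using subbase F(1) by (meson subsetD)
  then obtain f g where fg: "\<forall>\<D>\<in>\<F>. f \<D> \<in> \<D> \<and> openin K (g \<D>) \<and> k \<in> g \<D> \<and>
      (\<forall>x\<in>X. j x \<in> g \<D> \<longrightarrow> x \<in> f \<D>)"
    unfolding bchoice_iff by auto
  have "X \<inter> (\<Inter>\<D>\<in>\<F>. f \<D>) \<in> common_refinement X \<F>"
    using fg unfolding common_refinement_def by auto
  then obtain A where A: "A \<in> \<C>" "X \<inter> (\<Inter>\<D>\<in>\<F>. f \<D>) \<subseteq> A"
    using F(3) unfolding refines_def by auto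
  define N where "N = (\<Inter>\<D>\<in>\<F>. g \<D>) \<inter> topspace K"
  have "openin K N" unfolding N_def using F(2) fg by (intro openin_INT) auto
  moreover have "k \<in> N" using k fg by (auto simp: N_def)
  moreover have "\<forall>x\<in>X. j x \<in> N \<longrightarrow> x \<in> A" using A(2) fg by (auto simp: N_def)
  ultimately show ?thesis using A(1) by (intro bexI exI conjI)
qed

section \<open>Compact spaces that realise a covering uniformity\<close>

text \<open>
  The last two assumptions express, without mentioning the unique uniformity of the compact
  space \<open>K\<close>, that it induces the uniformity \<open>\<U>\<close> along \<open>j\<close>: \<open>coarse\<close> says that every cover in
  \<open>\<U>\<close> is refined by the trace of an open cover of \<open>K\<close>, and \<open>separating\<close> that \<open>\<U>\<close> has enough
  covers to tell the points of \<open>K\<close> apart.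
\<close>

locale cover_compactification =
  fixes X :: "'a set" and \<U> :: "'a set set set" and K :: "'b topology" and j :: "'a \<Rightarrow> 'b"
  assumes covers: "\<U> \<subseteq> covers_of X"
    and nonempty: "\<U> \<noteq> {}"
    and meet: "\<And>\<C> \<D>. \<lbrakk>\<C> \<in> \<U>; \<D> \<in> \<U>\<rbrakk> \<Longrightarrow> cover_meet \<C> \<D> \<in> \<U>"
    and compact: "compact_space K"
    and Hausdorff: "Hausdorff_space K"
    and dense: "K closure_of (j ` X) = topspace K"
    and maps: "\<And>x. x \<in> X \<Longrightarrow> j x \<in> topspace K"
    and coarse: "\<And>\<C> k. \<lbrakk>\<C> \<in> \<U>; k \<in> topspace K\<rbrakk> \<Longrightarrow>
      \<exists>A\<in>\<C>. \<exists>N. openin K N \<and> k \<in> N \<and> (\<forall>x\<in>X. j x \<in> N \<longrightarrow> x \<in> A)"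
    and separating: "\<And>k l. \<lbrakk>k \<in> topspace K; l \<in> topspace K; k \<noteq> l\<rbrakk> \<Longrightarrow>
      \<exists>\<C>\<in>\<U>. \<exists>N N'. openin K N \<and> k \<in> N \<and> openin K N' \<and> l \<in> N' \<and>
        (\<forall>A\<in>\<C>. \<forall>x\<in>A. \<forall>y\<in>A. \<not> (j x \<in> N \<and> j y \<in> N'))"
begin

lemma openin_uniform:
  "openin (uniform_topology X \<U>) W \<longleftrightarrow>
    W \<subseteq> X \<and> (\<forall>x\<in>W. \<exists>\<C>\<in>\<U>. cover_star \<C> x \<subseteq> W)"
  by (rule openin_uniform_topology) (rule meet[unfolded cover_meet_def])

lemma cover_subset: "\<lbrakk>\<C> \<in> \<U>; A \<in> \<C>\<rbrakk> \<Longrightarrow> A \<subseteq> X"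
  using covers by (auto simp: covers_of_def)

lemma dense_meets: "\<lbrakk>openin K N; k \<in> N\<rbrakk> \<Longrightarrow> \<exists>x\<in>X. j x \<in> N"
proof -
  assume "openin K N" "k \<in> N"
  moreover then have "k \<in> K closure_of (j ` X)" using dense openin_subset by blast
  ultimately show ?thesis unfolding in_closure_of by blast
qed

text \<open>
  The uniform form of separation: near \<open>k\<close>, the members of a suitable cover in \<open>\<U>\<close> are smaller
  than the given neighbourhood \<open>V\<close>.  Each point outside \<open>V\<close> is kept apart from \<open>k\<close> on a
  neighbourhood by some cover; by compactness of the complement of \<open>V\<close> finitely many covers suffice,
  and their meet works.
\<close>

lemma small_cover:
  assumes V: "openin K V" "k \<in> V"
  obtains \<C> N where "\<C> \<in> \<U>" "openin K N" "k \<in> N"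
    "\<And>A x y. \<lbrakk>A \<in> \<C>; x \<in> A; y \<in> A; j x \<in> N\<rbrakk> \<Longrightarrow> j y \<in> V"
proof -
  define avoids where "avoids S \<longleftrightarrow> (\<exists>\<C>\<in>\<U>. \<exists>N. openin K N \<and> k \<in> N \<and>
    (\<forall>A\<in>\<C>. \<forall>x\<in>A. \<forall>y\<in>A. \<not> (j x \<in> N \<and> j y \<in> S)))" for S
  have k: "k \<in> topspace K" using V openin_subset by blast
  have avoids_empty: "avoids {}"
    unfolding avoids_def using nonempty k by blast
  have avoids_Un: "avoids (S \<union> T)" if "avoids S" "avoids T" for S T
  proof -
    obtain \<C> N where C: "\<C> \<in> \<U>" "openin K N" "k \<in> N"
      "\<forall>A\<in>\<C>. \<forall>x\<in>A. \<forall>y\<in>A. \<not> (j x \<in> N \<and> j y \<in> S)"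
      using \<open>avoids S\<close> unfolding avoids_def by blast
    obtain \<D> M where D: "\<D> \<in> \<U>" "openin K M" "k \<in> M"
      "\<forall>A\<in>\<D>. \<forall>x\<in>A. \<forall>y\<in>A. \<not> (j x \<in> M \<and> j y \<in> T)"
      using \<open>avoids T\<close> unfolding avoids_def by blast
    have apart: "\<forall>E\<in>cover_meet \<C> \<D>. \<forall>x\<in>E. \<forall>y\<in>E. \<not> (j x \<in> N \<inter> M \<and> j y \<in> S \<union> T)"
      using C(4) D(4) by (auto elim!: cover_meetE)
    have NM: "openin K (N \<inter> M)" "k \<in> N \<inter> M" using C D by auto
    show ?thesis
      unfolding avoids_def
      by (intro bexI[OF _ meet[OF C(1) D(1)]] exI[of _ "N \<inter> M"] conjI NM apart)
  qed
  define \<W> where "\<W> = {W. openin K W \<and> avoids W}"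
  have "compactin K (topspace K - V)"
    using compact closedin_compact_space V(1) by blast
  moreover have "\<forall>W\<in>\<W>. openin K W" by (auto simp: \<W>_def)
  moreover have "topspace K - V \<subseteq> \<Union>\<W>"
  proof
    fix l assume "l \<in> topspace K - V"
    then obtain \<C> N N' where "\<C>\<in>\<U>" "openin K N" "k \<in> N" "openin K N'" "l \<in> N'"
        "\<forall>A\<in>\<C>. \<forall>x\<in>A. \<forall>y\<in>A. \<not> (j x \<in> N \<and> j y \<in> N')"
      using separating[of k l] V k by blast
    then show "l \<in> \<Union>\<W>" unfolding \<W>_def avoids_def by blast
  qed
  ultimately obtain \<F> where F: "finite \<F>" "\<F> \<subseteq> \<W>" "topspace K - V \<subseteq> \<Union>\<F>"
    unfolding compactin_def by meson
  define R where "R = \<Union>\<F>"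
  from F(1,2) have "avoids R"
    unfolding R_def
    by (induction rule: finite_induct) (auto simp: avoids_empty \<W>_def intro!: avoids_Un)
  then obtain \<C> N where C: "\<C> \<in> \<U>" "openin K N" "k \<in> N"
      "\<forall>A\<in>\<C>. \<forall>x\<in>A. \<forall>y\<in>A. \<not> (j x \<in> N \<and> j y \<in> R)"
    unfolding avoids_def by blast
  show ?thesis
  proof (rule that[OF C(1-3)])
    fix A x y assume A: "A \<in> \<C>" "x \<in> A" "y \<in> A" "j x \<in> N"
    then have "j y \<in> topspace K" using maps cover_subset[OF C(1) A(1)] by blast
    then show "j y \<in> V" using A C(4) F(3) unfolding R_def[symmetric] by blast
  qed
qed

lemma pullback_eq_uniform_topology: "pullback_topology X j K = uniform_topology X \<U>"
proof (rule topology_eq[THEN iffD2], intro allI iffI)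
  fix W assume "openin (pullback_topology X j K) W"
  then obtain V where V: "openin K V" "W = j -` V \<inter> X" unfolding openin_pullback_topology by blast
  have "\<exists>\<C>\<in>\<U>. cover_star \<C> x \<subseteq> W" if x: "x \<in> W" for x
  proof -
    obtain \<C> N where "\<C> \<in> \<U>" "j x \<in> N"
      "\<And>A y. \<lbrakk>A \<in> \<C>; x \<in> A; y \<in> A; j x \<in> N\<rbrakk> \<Longrightarrow> j y \<in> V"
      using small_cover[OF V(1), of "j x"] x V(2) by (metis IntD1 vimageD)
    then show ?thesis using V(2) cover_subset unfolding cover_star_def by blast
  qed
  then show "openin (uniform_topology X \<U>) W"
    unfolding openin_uniform using V(2) by blast
next
  fix W assume "openin (uniform_topology X \<U>) W"
  then have W: "W \<subseteq> X" "\<And>x. x \<in> W \<Longrightarrow> \<exists>\<C>\<in>\<U>. cover_star \<C> x \<subseteq> W"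
    unfolding openin_uniform by blast+
  have around: "\<exists>V. openin K V \<and> j x \<in> V \<and> j -` V \<inter> X \<subseteq> W" if x: "x \<in> W" for x
  proof -
    obtain \<C> where C: "\<C> \<in> \<U>" "cover_star \<C> x \<subseteq> W" using W(2)[OF x] by blast
    have xX: "x \<in> X" using x W(1) by blast
    obtain A N where A: "A \<in> \<C>" "openin K N" "j x \<in> N" "\<forall>x\<in>X. j x \<in> N \<longrightarrow> x \<in> A"
      using coarse[OF C(1) maps[OF xX]] by blast
    have "A \<subseteq> cover_star \<C> x" using A xX by (auto simp: cover_star_def)
    moreover have "j -` N \<inter> X \<subseteq> A" using A(4) by blast
    ultimately have "j -` N \<inter> X \<subseteq> W" using C(2) by (meson subset_trans)
    then show ?thesis using A(2,3) by (intro exI[of _ N]) simp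
  qed
  define V where "V = \<Union>{V. openin K V \<and> j -` V \<inter> X \<subseteq> W}"
  have "openin K V" unfolding V_def by blast
  moreover have "W = j -` V \<inter> X"
  proof
    show "W \<subseteq> j -` V \<inter> X"
    proof
      fix x assume x: "x \<in> W"
      then have "j x \<in> V" using around[OF x] unfolding V_def by blast
      then show "x \<in> j -` V \<inter> X" using x W(1) by blast
    qed
    show "j -` V \<inter> X \<subseteq> W" unfolding V_def by blast
  qed
  ultimately show "openin (pullback_topology X j K) W"
    unfolding openin_pullback_topology by blast
qed

text \<open>
  Points off \<open>X\<close> are cut away because nothing is known about \<open>j\<close> there.
\<close>

definition trace_filter :: "'b \<Rightarrow> 'a filter" where
  "trace_filter k = inf (filtercomap j (nhdsin K k)) (principal X)"

lemma eventually_trace_filter: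
  assumes "k \<in> topspace K"
  shows "eventually P (trace_filter k) \<longleftrightarrow> (\<exists>N. openin K N \<and> k \<in> N \<and> (\<forall>x\<in>X. j x \<in> N \<longrightarrow> P x))"
proof
  assume "eventually P (trace_filter k)"
  then show "\<exists>N. openin K N \<and> k \<in> N \<and> (\<forall>x\<in>X. j x \<in> N \<longrightarrow> P x)"
    unfolding trace_filter_def eventually_inf_principal eventually_filtercomap eventually_nhdsin
    using assms by blast
next
  assume "\<exists>N. openin K N \<and> k \<in> N \<and> (\<forall>x\<in>X. j x \<in> N \<longrightarrow> P x)"
  then obtain N where N: "openin K N" "k \<in> N" "\<forall>x\<in>X. j x \<in> N \<longrightarrow> P x" by blast
  then have "eventually (\<lambda>l. l \<in> N) (nhdsin K k)"
    unfolding eventually_nhdsin by blast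
  then show "eventually P (trace_filter k)"
    unfolding trace_filter_def eventually_inf_principal eventually_filtercomap using N(3) by blast
qed

lemma cauchy_trace_filter:
  assumes k: "k \<in> topspace K"
  shows "cauchy_filter_on X \<U> (trace_filter k)"
  unfolding cauchy_filter_on_def
proof (intro conjI ballI)
  show "trace_filter k \<noteq> bot"
    using dense_meets unfolding trivial_limit_def eventually_trace_filter[OF k] by blast
  show "trace_filter k \<le> principal X" by (simp add: trace_filter_def)
  fix \<C> assume "\<C> \<in> \<U>"
  then show "\<exists>A\<in>\<C>. \<forall>\<^sub>F x in trace_filter k. x \<in> A"
    unfolding eventually_trace_filter[OF k] using coarse[OF _ k] by blast
qed

text \<open>
  The image of a Cauchy filter in the compact space \<open>K\<close> has a cluster point \<open>k\<close>.  The filter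
  contains a member of the cover given by \<open>small_cover\<close>; this member meets the small neighbourhood
  of \<open>k\<close>, hence is contained in the given one.  So the filter converges to \<open>k\<close>.
\<close>

lemma cauchy_le_trace_filter:
  assumes F: "cauchy_filter_on X \<U> F"
  obtains k where "k \<in> topspace K" "F \<le> trace_filter k"
proof -
  have F_X: "eventually (\<lambda>x. x \<in> X) F" 
    using F by (simp add: cauchy_filter_on_def le_principal)
  obtain k where k: "k \<in> topspace K"
    and cluster: "\<And>V. \<lbrakk>openin K V; k \<in> V\<rbrakk> \<Longrightarrow> \<not> eventually (\<lambda>x. j x \<notin> V) F"
  proof (rule ccontr)
    define \<W> where "\<W> = {V. openin K V \<and> eventually (\<lambda>x. j x \<notin> V) F}"
    assume "\<not> thesis"
    then have "topspace K \<subseteq> \<Union>\<W>" using that unfolding \<W>_def by blast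
    moreover have "\<forall>V\<in>\<W>. openin K V" by (simp add: \<W>_def)
    ultimately obtain \<F> where Fin: "finite \<F>" "\<F> \<subseteq> \<W>" "topspace K \<subseteq> \<Union>\<F>"
      using compact unfolding compact_space_def compactin_def by meson
    have "eventually (\<lambda>x. \<forall>V\<in>\<F>. j x \<notin> V) F"
      using Fin(1,2) by (auto simp: eventually_ball_finite_distrib \<W>_def)
    with F_X have "eventually (\<lambda>x. False) F"
      by eventually_elim (use Fin(3) maps in blast)
    then show False using F by (simp add: cauchy_filter_on_def trivial_limit_def)
  qed
  have "F \<le> trace_filter k"
  proof (rule filter_leI)
    fix P assume "eventually P (trace_filter k)"
    then obtain V where V: "openin K V" "k \<in> V" "\<forall>x\<in>X. j x \<in> V \<longrightarrow> P x"
      unfolding eventually_trace_filter[OF k] by blast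
    obtain \<C> N where C: "\<C> \<in> \<U>" "openin K N" "k \<in> N"
      "\<And>A x y. \<lbrakk>A \<in> \<C>; x \<in> A; y \<in> A; j x \<in> N\<rbrakk> \<Longrightarrow> j y \<in> V"
      using small_cover[OF V(1,2)] by blast
    obtain A where A: "A \<in> \<C>" "eventually (\<lambda>x. x \<in> A) F"
      using F C(1) unfolding cauchy_filter_on_def by blast
    have "\<exists>x\<in>A. j x \<in> N"
    proof (rule ccontr)
      assume "\<not> ?thesis"
      then have "eventually (\<lambda>x. j x \<notin> N) F" using A(2) by (auto elim: eventually_mono)
      then show False using cluster C by blast
    qed
    then have "\<forall>y\<in>A. j y \<in> V" using C(4) A(1) by blast
    then have "\<forall>y\<in>A. P y" using V(3) cover_subset[OF C(1) A(1)] by blast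
    then show "eventually P F" using A(2) by (auto elim: eventually_mono)
  qed
  with k show ?thesis using that by blast
qed

lemma trace_filter_inj_le:
  assumes k: "k \<in> topspace K" and l: "l \<in> topspace K" and "trace_filter k \<le> trace_filter l"
  shows "k = l"
proof (rule ccontr)
  assume "k \<noteq> l"
  then obtain N M where NM: "openin K N" "openin K M" "k \<in> N" "l \<in> M" "disjnt N M"
    using Hausdorff k l unfolding Hausdorff_space_def by blast
  then have "eventually (\<lambda>x. j x \<in> N) (trace_filter k)" "eventually (\<lambda>x. j x \<in> M) (trace_filter l)"
    using eventually_trace_filter k l by blast+
  then have "eventually (\<lambda>x. j x \<in> N \<and> j x \<in> M) (trace_filter k)"
    using assms(3) by (auto simp: eventually_conj_iff le_filter_def)
  then have "eventually (\<lambda>x. False) (trace_filter k)"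
    by (rule eventually_mono) (use NM(5) in \<open>auto simp: disjnt_iff\<close>)
  then show False using cauchy_trace_filter[OF k] by (simp add: cauchy_filter_on_def trivial_limit_def)
qed

text \<open>
  Every Cauchy filter refines a trace filter, and distinct trace filters are incomparable;
  so the trace filters are exactly the minimal Cauchy filters.
\<close>

lemma completion_carrier_eq: "completion_carrier X \<U> = trace_filter ` topspace K"
proof (intro equalityI subsetI)
  fix F assume "F \<in> completion_carrier X \<U>"
  then show "F \<in> trace_filter ` topspace K"
    unfolding completion_carrier_def using cauchy_le_trace_filter cauchy_trace_filter by blast
next
  fix F assume "F \<in> trace_filter ` topspace K"
  then obtain k where k: "k \<in> topspace K" "F = trace_filter k" by blast
  have "G = F" if G: "cauchy_filter_on X \<U> G" "F \<le> G" for G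
  proof -
    obtain l where l: "l \<in> topspace K" "G \<le> trace_filter l" using cauchy_le_trace_filter[OF G(1)] .
    then have "k = l" using trace_filter_inj_le k G(2) by (metis order_trans)
    then show ?thesis using l k G(2) by (simp add: order_antisym)
  qed
  then show "F \<in> completion_carrier X \<U>"
    unfolding completion_carrier_def using k cauchy_trace_filter by blast
qed

text \<open>
  It suffices to test the extensions of the covers in \<open>\<U>\<close>, because they generate the uniformity
  of the completion.
\<close>

lemma openin_completion_topology:
  "openin (completion_topology X \<U>) W \<longleftrightarrow> W \<subseteq> completion_carrier X \<U> \<and>
    (\<forall>F\<in>W. \<exists>\<C>\<in>\<U>. \<forall>A\<in>\<C>. F \<in> completion_extend X \<U> A \<longrightarrow> completion_extend X \<U> A \<subseteq> W)"
proof -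
  let ?V = "completion_uniformity X \<U>" and ?Y = "completion_carrier X \<U>"
  let ?ext = "completion_extend X \<U>"
  have ext_sub: "?ext A \<subseteq> ?Y" for A by (auto simp: completion_extend_def)
  have ext_cover: "?ext ` \<C> \<in> ?V" if "\<C> \<in> \<U>" for \<C>
  proof -
    have "\<Union>(?ext ` \<C>) = ?Y"
      using that unfolding completion_extend_def completion_carrier_def cauchy_filter_on_def
      by blast
    then show ?thesis using ext_sub that
      unfolding completion_uniformity_def covers_of_def refines_def by blast
  qed
  have meet': "cover_meet \<C> \<D> \<in> ?V" if C: "\<C> \<in> ?V" and D: "\<D> \<in> ?V" for \<C> \<D>
  proof -
    obtain \<A> \<B> where AB: "\<A> \<in> \<U>" "refines (?ext ` \<A>) \<C>" "\<B> \<in> \<U>" "refines (?ext ` \<B>) \<D>"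
      using C D unfolding completion_uniformity_def by blast
    have "refines (?ext ` cover_meet \<A> \<B>) (cover_meet \<C> \<D>)"
      unfolding refines_def
    proof
      fix E assume "E \<in> ?ext ` cover_meet \<A> \<B>"
      then obtain A B where E: "A \<in> \<A>" "B \<in> \<B>" "E = ?ext (A \<inter> B)"
        by (auto elim!: cover_meetE)
      obtain A' B' where AB': "A' \<in> \<C>" "?ext A \<subseteq> A'" "B' \<in> \<D>" "?ext B \<subseteq> B'"
        using AB E unfolding refines_def by (meson imageI)
      have "?ext (A \<inter> B) = ?ext A \<inter> ?ext B"
        unfolding completion_extend_def by (auto simp: eventually_conj_iff)
      then have "E \<subseteq> A' \<inter> B'" using E(3) AB' by blast
      then show "\<exists>F\<in>cover_meet \<C> \<D>. E \<subseteq> F" using cover_meetI[OF AB'(1,3)] by blast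
    qed
    moreover have "cover_meet \<C> \<D> \<in> covers_of ?Y"
      using C D by (intro cover_meet_covers_of) (simp_all add: completion_uniformity_def)
    ultimately show ?thesis
      using meet[OF AB(1,3)] by (auto simp: completion_uniformity_def)
  qed
  have "(\<exists>\<D>\<in>?V. cover_star \<D> F \<subseteq> W) \<longleftrightarrow>
      (\<exists>\<C>\<in>\<U>. \<forall>A\<in>\<C>. F \<in> ?ext A \<longrightarrow> ?ext A \<subseteq> W)" for F
  proof
    assume "\<exists>\<D>\<in>?V. cover_star \<D> F \<subseteq> W"
    then obtain \<D> \<C> where D: "cover_star \<D> F \<subseteq> W" "\<C> \<in> \<U>" "refines (?ext ` \<C>) \<D>"
      unfolding completion_uniformity_def by blast
    have "?ext A \<subseteq> W" if A: "A \<in> \<C>" "F \<in> ?ext A" for A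
    proof -
      obtain B where B: "B \<in> \<D>" "?ext A \<subseteq> B" using D(3) A(1) unfolding refines_def by auto
      then have "B \<subseteq> cover_star \<D> F" using A(2) by (auto simp: cover_star_def)
      then show ?thesis using B(2) D(1) by blast
    qed
    then show "\<exists>\<C>\<in>\<U>. \<forall>A\<in>\<C>. F \<in> ?ext A \<longrightarrow> ?ext A \<subseteq> W"
      using D(2) by (intro bexI[of _ \<C>]) simp_all
  next
    assume "\<exists>\<C>\<in>\<U>. \<forall>A\<in>\<C>. F \<in> ?ext A \<longrightarrow> ?ext A \<subseteq> W"
    then obtain \<C> where C: "\<C> \<in> \<U>" "\<forall>A\<in>\<C>. F \<in> ?ext A \<longrightarrow> ?ext A \<subseteq> W" by blast
    then have "cover_star (?ext ` \<C>) F \<subseteq> W" unfolding cover_star_def by blast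
    then show "\<exists>\<D>\<in>?V. cover_star \<D> F \<subseteq> W"
      using ext_cover[OF C(1)] by (intro bexI)
  qed
  then show ?thesis
    unfolding completion_topology_def
    by (subst openin_uniform_topology) (simp_all add: meet'[unfolded cover_meet_def])
qed

lemma topspace_completion: "topspace (completion_topology X \<U>) = completion_carrier X \<U>"
proof -
  have "openin (completion_topology X \<U>) (completion_carrier X \<U>)"
    unfolding openin_completion_topology using nonempty by (auto simp: completion_extend_def)
  then show ?thesis
    using openin_completion_topology by (meson openin_subset openin_topspace subset_antisym)
qed

lemma trace_filter_in_extend:
  "k \<in> topspace K \<Longrightarrow> trace_filter k \<in> completion_extend X \<U> A \<longleftrightarrow>
    (\<exists>N. openin K N \<and> k \<in> N \<and> (\<forall>x\<in>X. j x \<in> N \<longrightarrow> x \<in> A))"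
  using completion_carrier_eq eventually_trace_filter by (auto simp: completion_extend_def)

text \<open>
  Continuity comes from \<open>coarse\<close>, openness from \<open>small_cover\<close>.
\<close>

theorem homeomorphic_map_trace_filter: "homeomorphic_map K (completion_topology X \<U>) trace_filter"
proof (rule bijective_open_imp_homeomorphic_map)
  show "trace_filter ` topspace K = topspace (completion_topology X \<U>)"
    by (simp add: topspace_completion completion_carrier_eq)
  show "inj_on trace_filter (topspace K)"
    using trace_filter_inj_le by (auto simp: inj_on_def)
  show "continuous_map K (completion_topology X \<U>) trace_filter"
    unfolding continuous_map_def
  proof (intro conjI allI impI)
    show "trace_filter \<in> topspace K \<rightarrow> topspace (completion_topology X \<U>)"
      by (auto simp: topspace_completion completion_carrier_eq)
    fix W assume "openin (completion_topology X \<U>) W"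
    then have W: "\<And>F. F \<in> W \<Longrightarrow>
        \<exists>\<C>\<in>\<U>. \<forall>A\<in>\<C>. F \<in> completion_extend X \<U> A \<longrightarrow> completion_extend X \<U> A \<subseteq> W"
      unfolding openin_completion_topology by blast
    show "openin K {k \<in> topspace K. trace_filter k \<in> W}"
    proof (subst openin_subopen, intro ballI)
      fix k assume "k \<in> {k \<in> topspace K. trace_filter k \<in> W}"
      then have k: "k \<in> topspace K" "trace_filter k \<in> W" by auto
      obtain \<C> where C: "\<C> \<in> \<U>"
        "\<forall>A\<in>\<C>. trace_filter k \<in> completion_extend X \<U> A \<longrightarrow> completion_extend X \<U> A \<subseteq> W"
        using W[OF k(2)] by blast
      obtain A N where A: "A \<in> \<C>" "openin K N" "k \<in> N" "\<forall>x\<in>X. j x \<in> N \<longrightarrow> x \<in> A"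
        using coarse[OF C(1) k(1)] by blast
      have N: "N \<subseteq> topspace K" using A(2) openin_subset by blast
      have "trace_filter l \<in> completion_extend X \<U> A" if "l \<in> N" for l
        using trace_filter_in_extend A that N by blast
      then have "N \<subseteq> {k \<in> topspace K. trace_filter k \<in> W}" using C(2) A N by blast
      then show "\<exists>T. openin K T \<and> k \<in> T \<and> T \<subseteq> {k \<in> topspace K. trace_filter k \<in> W}"
        using A by blast
    qed
  qed
  show "open_map K (completion_topology X \<U>) trace_filter"
    unfolding open_map_def
  proof (intro allI impI)
    fix V assume V: "openin K V"
    show "openin (completion_topology X \<U>) (trace_filter ` V)"
      unfolding openin_completion_topology
    proof (intro conjI ballI)
      show "trace_filter ` V \<subseteq> completion_carrier X \<U>"
        using V openin_subset completion_carrier_eq by blast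
      fix F assume "F \<in> trace_filter ` V"
      then obtain k where k: "k \<in> V" "F = trace_filter k" by blast
      then have kK: "k \<in> topspace K" using V openin_subset by blast
      \<comment> \<open>a member of the extended cover is only known to lie in the closure of its trace,
        so a smaller neighbourhood with closure in \<open>V\<close> is needed\<close>
      obtain V' where V': "openin K V'" "k \<in> V'" "K closure_of V' \<subseteq> V"
      proof -
        have "regular_space K" using compact Hausdorff compact_Hausdorff_imp_regular_space by blast
        then have "neighbourhood_base_of (closedin K) K"
          by (simp add: neighbourhood_base_of_closedin)
        then have "\<exists>V' C. openin K V' \<and> closedin K C \<and> k \<in> V' \<and> V' \<subseteq> C \<and> C \<subseteq> V"
          using V k(1) by (simp add: neighbourhood_base_of)
        then obtain V' C where V': "openin K V'" "closedin K C" "k \<in> V'" "V' \<subseteq> C" "C \<subseteq> V"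
          by blast
        then have "K closure_of V' \<subseteq> V" using closure_of_minimal[of V' C K] by blast
        then show ?thesis using that V'(1,3) by blast
      qed
      obtain \<C> N where C: "\<C> \<in> \<U>" "openin K N" "k \<in> N"
        "\<And>A x y. \<lbrakk>A \<in> \<C>; x \<in> A; y \<in> A; j x \<in> N\<rbrakk> \<Longrightarrow> j y \<in> V'"
        using small_cover[OF V'(1,2)] by blast
      have "completion_extend X \<U> A \<subseteq> trace_filter ` V"
        if A: "A \<in> \<C>" "trace_filter k \<in> completion_extend X \<U> A" for A
      proof
        fix G assume G: "G \<in> completion_extend X \<U> A"
        then obtain l where l: "l \<in> topspace K" "G = trace_filter l"
          using completion_carrier_eq by (auto simp: completion_extend_def)
        obtain M where M: "openin K M" "k \<in> M" "\<forall>x\<in>X. j x \<in> M \<longrightarrow> x \<in> A"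
          using A(2) trace_filter_in_extend[OF kK] by blast
        obtain x where x: "x \<in> X" "j x \<in> M \<inter> N"
          using dense_meets[of "M \<inter> N" k] M C by blast
        then have A_V': "\<forall>y\<in>A. j y \<in> V'" using M C(4) A(1) by blast
        obtain L where L: "openin K L" "l \<in> L" "\<forall>x\<in>X. j x \<in> L \<longrightarrow> x \<in> A"
          using G l trace_filter_in_extend by blast
        have "\<exists>y\<in>V'. y \<in> T" if T: "l \<in> T \<and> openin K T" for T
        proof -
          obtain y where "y \<in> X" "j y \<in> T \<inter> L" using dense_meets[of "T \<inter> L" l] T L by blast
          then show ?thesis using L(3) A_V' by blast
        qed
        then have "l \<in> K closure_of V'" using l(1) unfolding in_closure_of by blast
        then show "G \<in> trace_filter ` V" using V'(3) l by blast
      qed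
      then show "\<exists>\<C>\<in>\<U>. \<forall>A\<in>\<C>. F \<in> completion_extend X \<U> A \<longrightarrow> completion_extend X \<U> A \<subseteq> trace_filter ` V"
        using C(1) k(2) by blast
    qed
  qed
qed

lemma trace_filter_map_eq: "x \<in> X \<Longrightarrow> trace_filter (j x) = completion_map X \<U> x"
proof -
  assume x: "x \<in> X"
  have top: "topspace (pullback_topology X j K) = X"
    using maps by (auto simp: topspace_pullback_topology)
  have "eventually P (trace_filter (j x)) \<longleftrightarrow> eventually P (nhdsin (pullback_topology X j K) x)" for P
    unfolding eventually_trace_filter[OF maps[OF x]] eventually_nhdsin openin_pullback_topology top
    using x by auto
  then show ?thesis
    by (simp add: filter_eq_iff completion_map_def pullback_eq_uniform_topology)
qed

end

section \<open>Transporting a median to the completion\<close>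

lemma continuous_map_triple:
  assumes "continuous_map K L f"
  shows "continuous_map (prod_topology K (prod_topology K K)) (prod_topology L (prod_topology L L))
    (\<lambda>(x, y, z). (f x, f y, f z))"
proof -
  have "continuous_map (prod_topology K (prod_topology K K)) L (f \<circ> fst)"
    "continuous_map (prod_topology K (prod_topology K K)) L (f \<circ> (fst \<circ> snd))"
    "continuous_map (prod_topology K (prod_topology K K)) L (f \<circ> (snd \<circ> snd))"
    using assms by (meson continuous_map_compose continuous_map_fst continuous_map_snd)+
  then show ?thesis
    by (simp add: case_prod_unfold continuous_map_paired comp_def)
qed

lemma eq_on_dense_triples:
  assumes "Hausdorff_space L" and dense: "K closure_of S = topspace K"
    and "continuous_map (prod_topology K (prod_topology K K)) L f"
    and "continuous_map (prod_topology K (prod_topology K K)) L g"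
    and "\<And>x y z. \<lbrakk>x \<in> S; y \<in> S; z \<in> S\<rbrakk> \<Longrightarrow> f (x, y, z) = g (x, y, z)"
    and "t \<in> topspace (prod_topology K (prod_topology K K))"
  shows "f t = g t"
proof (rule forall_in_closure_of_eq[OF _ assms(1,3,4), of t "S \<times> S \<times> S"])
  show "t \<in> prod_topology K (prod_topology K K) closure_of (S \<times> S \<times> S)"
    using assms(6) by (simp add: closure_of_Times dense)
qed (use assms(5) in auto)

text \<open>
  The description that defines the median of the completion is satisfied by the transported
  median of any compactification that is homeomorphic to the completion compatibly with the maps
  from \<open>X\<close>.  Triples from \<open>X\<close> are dense in the cube of the completion, so nothing else
  satisfies it.
\<close>

lemma mmc_median_transport:
  assumes X: "median_algebra X m"
    and comp: "median_compactification T m K mK j" and T: "topspace T = X"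
    and h: "homeomorphic_maps K (mmc_space X m) h k"
    and hj: "\<And>x. x \<in> X \<Longrightarrow> h (j x) = mmc_map X m x"
    and FGH: "F \<in> topspace (mmc_space X m)" "G \<in> topspace (mmc_space X m)"
      "H \<in> topspace (mmc_space X m)"
  shows "mmc_median X m F G H = h (mK (k F) (k G) (k H))"
proof -
  let ?L = "mmc_space X m" and ?i = "mmc_map X m"
  let ?L3 = "prod_topology ?L (prod_topology ?L ?L)"
  have K: "median_algebra (topspace K) mK" "Hausdorff_space K"
    "continuous_map (prod_topology K (prod_topology K K)) K (\<lambda>(x, y, z). mK x y z)"
    "continuous_map T K j" "K closure_of (j ` X) = topspace K"
    and hom: "\<And>x y z. \<lbrakk>x \<in> X; y \<in> X; z \<in> X\<rbrakk> \<Longrightarrow> j (m x y z) = mK (j x) (j y) (j z)"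
    using comp T unfolding median_compactification_def topological_median_algebra_def by auto
  have jK: "j x \<in> topspace K" if "x \<in> X" for x
    using K(4) that T by (auto simp: continuous_map_def)
  have cont: "continuous_map K ?L h" "continuous_map ?L K k"
    and kh: "\<And>x. x \<in> topspace K \<Longrightarrow> k (h x) = x"
    using h by (auto simp: homeomorphic_maps_def)
  have iL: "?i x \<in> topspace ?L" if "x \<in> X" for x
    using hj[OF that] jK[OF that] cont(1) by (auto simp: continuous_map_def Pi_iff)
  have ki: "k (?i x) = j x" if "x \<in> X" for x using kh jK hj that by metis
  have hmap: "homeomorphic_map K ?L h" using h homeomorphic_map_maps by blast
  have L: "Hausdorff_space ?L"
    using K(2) hmap homeomorphic_map_imp_homeomorphic_space homeomorphic_Hausdorff_space by blast
  have "?i ` X = h ` j ` X" using hj by (auto simp: image_iff)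
  then have dense: "?L closure_of (?i ` X) = topspace ?L"
    using homeomorphic_map_closure_of[OF hmap, of "j ` X"] jK K(5) hmap
      homeomorphic_imp_surjective_map[OF hmap] by auto
  define g0 where "g0 = restrict (\<lambda>(F, G, H). h (mK (k F) (k G) (k H))) (topspace ?L3)"
  let ?P = "\<lambda>g. g \<in> extensional (topspace ?L3) \<and> continuous_map ?L3 ?L g \<and>
      (\<forall>x\<in>X. \<forall>y\<in>X. \<forall>z\<in>X. g (?i x, ?i y, ?i z) = ?i (m x y z))"
  have "continuous_map ?L3 (prod_topology K (prod_topology K K)) (\<lambda>(F, G, H). (k F, k G, k H))"
    using cont(2) by (rule continuous_map_triple)
  then have "continuous_map ?L3 ?L (h \<circ> (\<lambda>(x, y, z). mK x y z) \<circ> (\<lambda>(F, G, H). (k F, k G, k H)))"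
    by (rule continuous_map_compose[OF _ continuous_map_compose[OF K(3) cont(1)]])
  then have g0_cont: "continuous_map ?L3 ?L g0"
    by (rule continuous_map_eq) (auto simp: g0_def)
  have mX: "m x y z \<in> X" if "x \<in> X" "y \<in> X" "z \<in> X" for x y z
    using median_algebra.median_closed[OF X] that .
  have P: "?P g0"
  proof (intro conjI ballI)
    show "g0 (?i x, ?i y, ?i z) = ?i (m x y z)" if "x \<in> X" "y \<in> X" "z \<in> X" for x y z
      using that iL ki mX by (simp add: g0_def hom[symmetric] hj)
  qed (simp_all add: g0_cont, simp add: g0_def)
  moreover have "g = g0" if g: "?P g" for g
  proof (rule extensionalityI)
    show "g \<in> extensional (topspace ?L3)" "g0 \<in> extensional (topspace ?L3)" using g P by auto
    fix t assume t: "t \<in> topspace ?L3"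
    show "g t = g0 t"
      by (rule eq_on_dense_triples[OF L dense _ _ _ t]) (use g P in auto)
  qed
  ultimately have "(THE g. ?P g) = g0" by (rule the_equality)
  then have "mmc_median X m F G H = g0 (F, G, H)" unfolding mmc_median_def Let_def by simp
  then show ?thesis using FGH by (simp add: g0_def)
qed

lemma mmc_compactification_transport:
  assumes X: "median_algebra X m"
    and comp: "median_compactification T m K mK j" and T: "topspace T = X"
    and h: "homeomorphic_map K (mmc_space X m) h"
    and hj: "\<And>x. x \<in> X \<Longrightarrow> h (j x) = mmc_map X m x"
  shows "median_compactification T m (mmc_space X m) (mmc_median X m) (mmc_map X m)"
    and "compactification_iso X K mK j (mmc_space X m) (mmc_median X m) (mmc_map X m) h"
proof -
  let ?L = "mmc_space X m" and ?i = "mmc_map X m" and ?mL = "mmc_median X m"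
  let ?L3 = "prod_topology ?L (prod_topology ?L ?L)"
  obtain k where hk: "homeomorphic_maps K ?L h k" using h homeomorphic_map_maps by blast
  have K: "median_algebra (topspace K) mK" "Hausdorff_space K" "compact_space K"
    "continuous_map (prod_topology K (prod_topology K K)) K (\<lambda>(x, y, z). mK x y z)"
    "continuous_map T K j" "K closure_of (j ` X) = topspace K"
    and hom: "\<And>x y z. \<lbrakk>x \<in> X; y \<in> X; z \<in> X\<rbrakk> \<Longrightarrow> j (m x y z) = mK (j x) (j y) (j z)"
    using comp T unfolding median_compactification_def topological_median_algebra_def by auto
  interpret K: median_algebra "topspace K" mK by fact
  interpret X: median_algebra X m by fact
  have jK: "j x \<in> topspace K" if "x \<in> X" for x
    using K(5) that T by (auto simp: continuous_map_def)
  have cont: "continuous_map K ?L h" "continuous_map ?L K k"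
    and kh: "\<And>x. x \<in> topspace K \<Longrightarrow> k (h x) = x"
    and hk': "\<And>F. F \<in> topspace ?L \<Longrightarrow> h (k F) = F"
    using hk by (auto simp: homeomorphic_maps_def)
  have kK: "k F \<in> topspace K" if "F \<in> topspace ?L" for F
    using cont(2) that by (auto simp: continuous_map_def)
  have hL: "h a \<in> topspace ?L" if "a \<in> topspace K" for a
    using cont(1) that by (auto simp: continuous_map_def)
  have mL: "?mL F G H = h (mK (k F) (k G) (k H))"
    if "F \<in> topspace ?L" "G \<in> topspace ?L" "H \<in> topspace ?L" for F G H
    using mmc_median_transport[OF X comp T hk hj that] .
  have mL_closed: "?mL F G H \<in> topspace ?L"
    if "F \<in> topspace ?L" "G \<in> topspace ?L" "H \<in> topspace ?L" for F G H
    using that by (simp add: mL hL kK K.median_closed)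
  have hmK: "h (mK a b c) = ?mL (h a) (h b) (h c)"
    if "a \<in> topspace K" "b \<in> topspace K" "c \<in> topspace K" for a b c
    using that by (simp add: mL hL kh)
  have "median_algebra (topspace ?L) ?mL"
  proof
    fix a b c x assume X: "a \<in> topspace ?L" "b \<in> topspace ?L" "c \<in> topspace ?L"
    show "?mL a b c \<in> topspace ?L" using X by (rule mL_closed)
    show "?mL a b c = ?mL b a c"
      using X K.median_swap12[of "k a" "k b" "k c"] by (simp add: mL kK)
    show "?mL a b c = ?mL a c b"
      using X K.median_swap23[of "k a" "k b" "k c"] by (simp add: mL kK)
    assume x: "x \<in> topspace ?L"
    have "?mL (?mL a x b) x c = h (mK (mK (k a) (k x) (k b)) (k x) (k c))"
      using X x by (simp add: mL mL_closed kh kK K.median_closed hL)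
    also have "\<dots> = h (mK (k a) (k x) (mK (k b) (k x) (k c)))"
      using X x by (simp add: K.median_assoc kK)
    also have "\<dots> = ?mL a x (?mL b x c)"
      using X x by (simp add: mL mL_closed kh kK K.median_closed hL)
    finally show "?mL (?mL a x b) x c = ?mL a x (?mL b x c)" .
  next
    fix a b assume "a \<in> topspace ?L" "b \<in> topspace ?L"
    then show "?mL a b b = b" by (simp add: mL kK K.median_absorb hk')
  qed
  moreover have "Hausdorff_space ?L" "compact_space ?L"
    using K(2,3) h homeomorphic_map_imp_homeomorphic_space homeomorphic_Hausdorff_space
      homeomorphic_compact_space by blast+
  moreover have "continuous_map ?L3 ?L (\<lambda>(F, G, H). ?mL F G H)"
  proof (rule continuous_map_eq)
    have "continuous_map ?L3 (prod_topology K (prod_topology K K)) (\<lambda>(F, G, H). (k F, k G, k H))"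
      using cont(2) by (rule continuous_map_triple)
    then show "continuous_map ?L3 ?L (h \<circ> (\<lambda>(x, y, z). mK x y z) \<circ> (\<lambda>(F, G, H). (k F, k G, k H)))"
      by (rule continuous_map_compose[OF _ continuous_map_compose[OF K(4) cont(1)]])
  qed (auto simp: mL)
  moreover have "continuous_map T ?L ?i"
    by (rule continuous_map_eq[OF continuous_map_compose[OF K(5) cont(1)]]) (simp add: T hj)
  moreover have "?L closure_of (?i ` X) = topspace ?L"
  proof -
    have "?i ` X = h ` j ` X" using hj by (auto simp: image_iff)
    then show ?thesis
      using homeomorphic_map_closure_of[OF h, of "j ` X"] jK K(6)
        homeomorphic_imp_surjective_map[OF h] by auto
  qed
  moreover have "?i (m x y z) = ?mL (?i x) (?i y) (?i z)" if "x \<in> X" "y \<in> X" "z \<in> X" for x y z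
    using that hmK[of "j x" "j y" "j z"] by (simp add: hj[symmetric] hom jK X.median_closed)
  ultimately show "median_compactification T m ?L ?mL ?i"
    unfolding median_compactification_def topological_median_algebra_def by (simp add: T)
  show "compactification_iso X K mK j ?L ?mL ?i h"
    unfolding compactification_iso_def using h hmK hj by blast
qed

lemma compactification_iso_unique:
  assumes K: "K closure_of (j ` X) = topspace K" and L: "Hausdorff_space L"
    and f: "compactification_iso X K mK j L mL i f" "f \<in> extensional (topspace K)"
    and g: "compactification_iso X K mK j L mL i g" "g \<in> extensional (topspace K)"
  shows "f = g"
proof (rule extensionalityI[OF f(2) g(2)])
  fix t assume "t \<in> topspace K"
  then have t: "t \<in> K closure_of (j ` X)" using K by simp
  show "f t = g t"
    by (rule forall_in_closure_of_eq[OF t L])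
      (use f(1) g(1) in \<open>auto simp: compactification_iso_def homeomorphic_imp_continuous_map\<close>)
qed

lemma compactification_iso_restrict:
  assumes "median_algebra (topspace K) mK" "\<And>x. x \<in> X \<Longrightarrow> j x \<in> topspace K"
    and h: "compactification_iso X K mK j L mL i h"
  shows "compactification_iso X K mK j L mL i (restrict h (topspace K))"
proof -
  have "homeomorphic_map K L (restrict h (topspace K))"
    using h homeomorphic_map_eq[of K L h "restrict h (topspace K)"]
    by (simp add: compactification_iso_def)
  then show ?thesis
    using h assms(2) median_algebra.median_closed[OF assms(1)]
    by (simp add: compactification_iso_def)
qed

section \<open>The Roller--Fioravanti compactification\<close>

text \<open>
  The name \<open>X\<close> for the carrier makes the facts about median algebras available in the form in
  which the compactifications mention it.
\<close>

locale compact_interval_median =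
  fixes \<sigma> :: "'a topology" and m :: "'a \<Rightarrow> 'a \<Rightarrow> 'a \<Rightarrow> 'a" and X :: "'a set"
  assumes topology: "topological_median_algebra \<sigma> m"
    and X_def: "X = topspace \<sigma>"
    and compact_intervals: "\<And>u v. \<lbrakk>u \<in> X; v \<in> X\<rbrakk> \<Longrightarrow> compactin \<sigma> (median_interval X m u v)"

sublocale compact_interval_median \<subseteq> median_algebra X m
  using topology by (simp add: topological_median_algebra_def X_def)

context compact_interval_median
begin

abbreviation "P \<equiv> rf_product \<sigma> m"
abbreviation "R \<equiv> rf_space \<sigma> m"
abbreviation "\<nu> \<equiv> rf_map X m"
abbreviation "M \<equiv> rf_median X m"

lemma Hausdorff_\<sigma>: "Hausdorff_space \<sigma>"
  using topology by (simp add: topological_median_algebra_def)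

lemma continuous_median:
  "continuous_map (prod_topology \<sigma> (prod_topology \<sigma> \<sigma>)) \<sigma> (\<lambda>(x, y, z). m x y z)"
  using topology by (simp add: topological_median_algebra_def)

lemma continuous_map_median:
  assumes "continuous_map Z \<sigma> f" "continuous_map Z \<sigma> g" "continuous_map Z \<sigma> h"
  shows "continuous_map Z \<sigma> (\<lambda>t. m (f t) (g t) (h t))"
proof -
  have "continuous_map Z (prod_topology \<sigma> (prod_topology \<sigma> \<sigma>)) (\<lambda>t. (f t, g t, h t))"
    using assms by (simp add: continuous_map_paired)
  from continuous_map_compose[OF this continuous_median] show ?thesis by (simp add: comp_def)
qed

lemma openin_branch:
  assumes "u \<in> X" "v \<in> X"
  shows "openin \<sigma> (branch X m u v)"
proof -
  have "continuous_map \<sigma> \<sigma> (\<lambda>x. m u x v)"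
    using assms by (intro continuous_map_median) (simp_all add: X_def)
  moreover have "openin \<sigma> (topspace \<sigma> - {v})"
    using assms Hausdorff_\<sigma> by (simp add: closedin_Hausdorff_singleton X_def openin_diff)
  ultimately have "openin \<sigma> {x \<in> topspace \<sigma>. m u x v \<in> topspace \<sigma> - {v}}"
    by (rule openin_continuous_map_preimage)
  moreover have "{x \<in> topspace \<sigma>. m u x v \<in> topspace \<sigma> - {v}} = branch X m u v"
    using assms median_closed by (auto simp: branch_def X_def)
  ultimately show ?thesis by simp
qed

lemma topspace_rf_product:
  "topspace P = (\<Pi>\<^sub>E (u, v) \<in> X \<times> X. median_interval X m u v)"
  unfolding rf_product_def X_def[symmetric]
  by (auto simp: PiE_iff median_interval_def X_def[symmetric])

lemma rf_product_coordinate: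
  assumes "k \<in> topspace P" "u \<in> X" "v \<in> X"
  shows "between u (k (u, v)) v"
  using assms by (auto simp: topspace_rf_product PiE_iff interval_iff_between)

lemma rf_product_eqI:
  assumes "k \<in> topspace P" "l \<in> topspace P" "\<And>u v. \<lbrakk>u \<in> X; v \<in> X\<rbrakk> \<Longrightarrow> k (u, v) = l (u, v)"
  shows "k = l"
  using assms unfolding topspace_rf_product by (intro PiE_ext) auto

lemma rf_product_memI:
  assumes "k \<in> extensional (X \<times> X)" "\<And>u v. \<lbrakk>u \<in> X; v \<in> X\<rbrakk> \<Longrightarrow> between u (k (u, v)) v"
  shows "k \<in> topspace P"
  using assms by (auto simp: topspace_rf_product PiE_iff interval_iff_between)

lemma compact_rf_product: "compact_space P"
  unfolding rf_product_def compact_space_product_topology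
  using compact_intervals compact_space_subtopology by (auto simp: X_def)

lemma Hausdorff_rf_product: "Hausdorff_space P"
  unfolding rf_product_def Hausdorff_space_product_topology
  using Hausdorff_\<sigma> Hausdorff_space_subtopology by auto

lemma continuous_coordinate:
  assumes "u \<in> X" "v \<in> X"
  shows "continuous_map P \<sigma> (\<lambda>k. k (u, v))"
  using continuous_map_product_projection[of "(u, v)" "topspace \<sigma> \<times> topspace \<sigma>"
      "\<lambda>(u, v). subtopology \<sigma> (median_interval (topspace \<sigma>) m u v)"] assms
  unfolding rf_product_def by (auto simp: X_def continuous_map_in_subtopology)

lemma rf_map_coordinate: "\<lbrakk>u \<in> X; v \<in> X\<rbrakk> \<Longrightarrow> \<nu> x (u, v) = m u x v"
  by (simp add: rf_map_def median_retraction_def)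

lemma rf_map_in_product: "x \<in> X \<Longrightarrow> \<nu> x \<in> topspace P"
  by (rule rf_product_memI) (auto simp: rf_map_coordinate between_median(3), simp add: rf_map_def)

lemma rf_median_coordinate:
  "\<lbrakk>u \<in> X; v \<in> X\<rbrakk> \<Longrightarrow> M f g h (u, v) = m (f (u, v)) (g (u, v)) (h (u, v))"
  by (simp add: rf_median_def)

lemma rf_median_in_product:
  assumes "f \<in> topspace P" "g \<in> topspace P" "h \<in> topspace P"
  shows "M f g h \<in> topspace P"
proof (rule rf_product_memI)
  show "between u (M f g h (u, v)) v" if "u \<in> X" "v \<in> X" for u v
    using interval_closed[of u "f (u, v)" v "g (u, v)" "h (u, v)"] rf_product_coordinate assms that
    by (simp add: rf_median_coordinate)
qed (simp add: rf_median_def)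

lemma rf_map_hom:
  assumes "x \<in> X" "y \<in> X" "z \<in> X"
  shows "\<nu> (m x y z) = M (\<nu> x) (\<nu> y) (\<nu> z)"
  using assms
  by (intro rf_product_eqI rf_median_in_product rf_map_in_product median_closed)
    (simp_all add: rf_median_coordinate rf_map_coordinate retraction_hom)

lemma rf_map_inj: "inj_on \<nu> X"
proof
  fix x y assume xy: "x \<in> X" "y \<in> X" "\<nu> x = \<nu> y"
  have "m x x y = m x y y" using xy rf_map_coordinate[of x y] by metis
  then show "x = y" using xy between_ends[of x y] by (metis between_def)
qed

lemma continuous_rf_median_product:
  "continuous_map (prod_topology P (prod_topology P P)) P (\<lambda>(f, g, h). M f g h)"
proof -
  let ?P3 = "prod_topology P (prod_topology P P)"
  let ?Y = "\<lambda>(u, v). subtopology \<sigma> (median_interval X m u v)"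
  have "continuous_map ?P3 (?Y p) (\<lambda>t. (case t of (f, g, h) \<Rightarrow> M f g h) p)"
    if pX: "p \<in> X \<times> X" for p
  proof -
    obtain u v where p: "p = (u, v)" "u \<in> X" "v \<in> X" using pX by blast
    have c: "continuous_map ?P3 \<sigma> (\<lambda>t. (fst t) p)" "continuous_map ?P3 \<sigma> (\<lambda>t. (fst (snd t)) p)"
      "continuous_map ?P3 \<sigma> (\<lambda>t. (snd (snd t)) p)"
      using continuous_map_compose[OF _ continuous_coordinate[OF p(2,3)], of ?P3 fst]
        continuous_map_compose[OF _ continuous_coordinate[OF p(2,3)], of ?P3 "fst \<circ> snd"]
        continuous_map_compose[OF _ continuous_coordinate[OF p(2,3)], of ?P3 "snd \<circ> snd"]
        continuous_map_compose[OF continuous_map_snd continuous_map_fst, of P P P]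
        continuous_map_compose[OF continuous_map_snd continuous_map_snd, of P P P]
      by (simp_all add: continuous_map_fst comp_def p(1))
    have "continuous_map ?P3 \<sigma> (\<lambda>t. (case t of (f, g, h) \<Rightarrow> M f g h) p)"
      using continuous_map_median[OF c] p by (simp add: case_prod_unfold rf_median_coordinate)
    moreover have "(case t of (f, g, h) \<Rightarrow> M f g h) p \<in> median_interval X m u v"
      if "t \<in> topspace ?P3" for t
      using that rf_product_coordinate[OF rf_median_in_product] p
      by (auto simp: interval_iff_between)
    ultimately show ?thesis by (auto simp: continuous_map_in_subtopology p(1))
  qed
  moreover have "M f g h \<in> extensional (X \<times> X)" for f g h
    by (simp add: rf_median_def)
  ultimately show ?thesis
    unfolding rf_product_def X_def[symmetric] continuous_map_componentwise by auto
qed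

lemma topspace_rf_space: "topspace R = P closure_of (\<nu> ` X)"
  by (simp add: rf_space_def X_def closure_of_subset_topspace inf_absorb2)

lemma rf_space_subset: "topspace R \<subseteq> topspace P"
  by (simp add: topspace_rf_space closure_of_subset_topspace)

lemma rf_space_eq: "R = subtopology P (topspace R)"
  by (simp add: topspace_rf_space) (simp add: rf_space_def X_def)

lemma rf_map_in_space: "x \<in> X \<Longrightarrow> \<nu> x \<in> topspace R"
  unfolding topspace_rf_space using closure_of_subset[of "\<nu> ` X" P] rf_map_in_product by blast

lemma compact_rf_space: "compact_space R"
  using closedin_compact_space[OF compact_rf_product closedin_closure_of]
  by (simp add: rf_space_def compact_space_subtopology)

lemma Hausdorff_rf_space: "Hausdorff_space R"
  unfolding rf_space_def using Hausdorff_rf_product by (rule Hausdorff_space_subtopology)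

lemma dense_rf_map: "R closure_of (\<nu> ` X) = topspace R"
proof -
  have "\<nu> ` X \<subseteq> topspace R" using rf_map_in_space by blast
  then have "R closure_of (\<nu> ` X) = topspace R \<inter> P closure_of (\<nu> ` X)"
    by (subst rf_space_eq) (simp add: closure_of_subtopology inf_absorb2)
  then show ?thesis by (simp add: topspace_rf_space)
qed

lemma openin_coordinate_preimage:
  assumes "u \<in> X" "v \<in> X" "openin \<sigma> W"
  shows "openin R {k \<in> topspace R. k (u, v) \<in> W}"
proof -
  have "continuous_map R \<sigma> (\<lambda>k. k (u, v))"
    by (subst rf_space_eq)
      (rule continuous_map_from_subtopology[OF continuous_coordinate[OF assms(1,2)]])
  then show ?thesis using assms(3) by (rule openin_continuous_map_preimage)
qed

text \<open>
  The coordinatewise median is continuous and maps triples from the image of \<open>X\<close> into that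
  image, so it preserves the closure.
\<close>

lemma rf_median_in_space:
  assumes "f \<in> topspace R" "g \<in> topspace R" "h \<in> topspace R"
  shows "M f g h \<in> topspace R"
proof -
  let ?S = "\<nu> ` X" and ?M = "\<lambda>(f, g, h). M f g h"
  have "(f, g, h) \<in> prod_topology P (prod_topology P P) closure_of (?S \<times> ?S \<times> ?S)"
    using assms by (simp add: closure_of_Times topspace_rf_space)
  then have "?M (f, g, h) \<in> P closure_of (?M ` (?S \<times> ?S \<times> ?S))"
    using continuous_map_image_closure_subset[OF continuous_rf_median_product] by blast
  moreover have "?M ` (?S \<times> ?S \<times> ?S) \<subseteq> ?S"
    using median_closed by (auto simp: rf_map_hom[symmetric])
  ultimately show ?thesis
    unfolding topspace_rf_space using closure_of_mono by (metis (no_types, lifting) case_prod_conv subsetD)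
qed

lemma median_algebra_rf: "median_algebra (topspace R) M"
proof
  have coord: "k (u, v) \<in> X" if "k \<in> topspace R" "u \<in> X" "v \<in> X" for k u v
    using rf_product_coordinate rf_space_subset that betweenD(2) by blast
  have eqI: "k = l" if "k \<in> topspace R" "l \<in> topspace R"
    "\<And>u v. \<lbrakk>u \<in> X; v \<in> X\<rbrakk> \<Longrightarrow> k (u, v) = l (u, v)" for k l
    using rf_product_eqI that rf_space_subset by blast
  fix a b c x assume X: "a \<in> topspace R" "b \<in> topspace R" "c \<in> topspace R"
  show "M a b c \<in> topspace R" using X by (rule rf_median_in_space)
  show "M a b c = M b a c"
    by (rule eqI) (use X in \<open>simp_all add: rf_median_in_space rf_median_coordinate coord median_swap12\<close>)
  show "M a b c = M a c b"
    by (rule eqI) (use X in \<open>simp_all add: rf_median_in_space rf_median_coordinate coord median_swap23\<close>)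
  show "M a b b = b"
    by (rule eqI) (use X in \<open>simp_all add: rf_median_in_space rf_median_coordinate coord median_absorb\<close>)
  assume "x \<in> topspace R"
  then show "M (M a x b) x c = M a x (M b x c)"
    by (intro eqI) (use X in \<open>simp_all add: rf_median_in_space rf_median_coordinate coord median_assoc\<close>)
qed

lemma topological_median_algebra_rf: "topological_median_algebra R M"
proof -
  let ?C = "topspace R"
  have "continuous_map (subtopology (prod_topology P (prod_topology P P)) (?C \<times> ?C \<times> ?C)) P
      (\<lambda>(f, g, h). M f g h)"
    using continuous_rf_median_product by (rule continuous_map_from_subtopology)
  then have "continuous_map (prod_topology R (prod_topology R R)) P (\<lambda>(f, g, h). M f g h)"
    by (simp add: subtopology_Times rf_space_eq[symmetric])
  then have "continuous_map (prod_topology R (prod_topology R R)) (subtopology P ?C) (\<lambda>(f, g, h). M f g h)"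
    using rf_median_in_space by (auto simp: continuous_map_in_subtopology)
  then show ?thesis
    using median_algebra_rf Hausdorff_rf_space
    by (simp add: topological_median_algebra_def rf_space_eq[symmetric])
qed

lemma branch_cover: "(u, v) \<in> chain_pairs X m \<Longrightarrow> {branch X m u v, branch X m v u} \<in> covers_of X"
  using chain_pairsD[of u v] median_swap13[of u _ v]
  by (auto simp: covers_of_def branch_def)

text \<open>
  The core of the argument: the median uniformity is the one that the compact space of the RF
  compactification induces on \<open>X\<close>.
\<close>

lemma rf_realises_median_uniformity:
  assumes T2: "T2m X m"
  shows "cover_compactification X (median_uniformity X m) R \<nu>"
proof
  let ?U = "median_uniformity X m"
  show "?U \<subseteq> covers_of X"
    by (auto simp: median_uniformity_def uniformity_from_subbase_def)
  show "?U \<noteq> {}"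
    using trivial_cover_in_uniformity unfolding median_uniformity_def by blast
  show "cover_meet \<C> \<D> \<in> ?U" if "\<C> \<in> ?U" "\<D> \<in> ?U" for \<C> \<D>
    using that unfolding median_uniformity_def by (rule cover_meet_in_uniformity)
  show "\<exists>A\<in>\<C>. \<exists>N. openin R N \<and> k \<in> N \<and> (\<forall>x\<in>X. \<nu> x \<in> N \<longrightarrow> x \<in> A)"
    if "\<C> \<in> ?U" and k: "k \<in> topspace R" for \<C> k
  proof (rule neighbourhood_in_uniform_cover[OF _ rf_map_in_space k \<open>\<C> \<in> ?U\<close>[unfolded median_uniformity_def]])
    fix \<B> assume "\<B> \<in> {{branch X m u v, branch X m v u} |u v. (u, v) \<in> chain_pairs X m}"
    then obtain u v where uv: "(u, v) \<in> chain_pairs X m" "\<B> = {branch X m u v, branch X m v u}"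
      by blast
    then have X: "u \<in> X" "v \<in> X" "u \<noteq> v" using chain_pairsD by blast+
    \<comment> \<open>\<open>b\<close> is an end of the chain that the coordinate of \<open>k\<close> avoids\<close>
    obtain a b where ab: "{a, b} = {u, v}" "k (u, v) \<noteq> b" using X by (metis doubleton_eq_iff)
    then have B: "branch X m a b \<in> \<B>" using uv(2) by (auto simp: doubleton_eq_iff)
    have bX: "b \<in> X" using ab X by (auto simp: doubleton_eq_iff)
    define N where "N = {l \<in> topspace R. l (u, v) \<in> topspace \<sigma> - {b}}"
    have "openin R N"
      unfolding N_def using X bX Hausdorff_\<sigma>
      by (intro openin_coordinate_preimage openin_diff)
        (simp_all add: X_def closedin_Hausdorff_singleton)
    moreover have "k \<in> N"
      using k ab(2) rf_product_coordinate[of k u v] X rf_space_subset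
      by (auto simp: N_def X_def[symmetric] between_def)
    moreover have "\<forall>x\<in>X. \<nu> x \<in> N \<longrightarrow> x \<in> branch X m a b"
      using ab(1) X median_swap13[of u _ v]
      by (auto simp: N_def branch_def rf_map_coordinate doubleton_eq_iff)
    ultimately show "\<exists>A\<in>\<B>. \<exists>N. openin R N \<and> k \<in> N \<and> (\<forall>x\<in>X. \<nu> x \<in> N \<longrightarrow> x \<in> A)"
      using B by (intro bexI exI conjI)
  qed
  show "\<exists>\<C>\<in>?U. \<exists>N N'. openin R N \<and> k \<in> N \<and> openin R N' \<and> l \<in> N' \<and>
      (\<forall>A\<in>\<C>. \<forall>x\<in>A. \<forall>y\<in>A. \<not> (\<nu> x \<in> N \<and> \<nu> y \<in> N'))"
    if k: "k \<in> topspace R" and l: "l \<in> topspace R" and "k \<noteq> l" for k l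
  proof -
    obtain u v where uv: "u \<in> X" "v \<in> X" "k (u, v) \<noteq> l (u, v)"
      using rf_product_eqI[of k l] k l \<open>k \<noteq> l\<close> rf_space_subset by blast
    have kl: "between u (k (u, v)) v" "between u (l (u, v)) v"
      using rf_product_coordinate uv k l rf_space_subset by blast+
    obtain a e b f c d where sep: "a \<in> X" "e \<in> X" "b \<in> X" "f \<in> X"
      and cd: "(c, d) \<in> chain_pairs X m"
      and p: "k (u, v) \<in> branch X m a e" and q: "l (u, v) \<in> branch X m b f"
      and left: "\<And>x. x \<in> branch X m a e \<Longrightarrow> m c x d = c"
      and right: "\<And>x. x \<in> branch X m b f \<Longrightarrow> m c x d = d"
      using separating_branches[OF T2 betweenD(2)[OF kl(1)] betweenD(2)[OF kl(2)] uv(3)] by blast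
    have X: "c \<in> X" "d \<in> X" "c \<noteq> d" using chain_pairsD[OF cd] by auto
    \<comment> \<open>what the coordinate \<open>(u, v)\<close> of \<open>\<nu> x\<close> says about \<open>[c, d]\<close> holds for \<open>x\<close> itself\<close>
    have factor: "m c (m u x v) d = m c x d" if "x \<in> X" for x
      using separating_chain_in_interval[OF cd kl left[OF p] right[OF q] that] .
    define N where "N = {i \<in> topspace R. i (u, v) \<in> branch X m a e}"
    define N' where "N' = {i \<in> topspace R. i (u, v) \<in> branch X m b f}"
    have "{branch X m c d, branch X m d c} \<in> ?U"
      unfolding median_uniformity_def using cd branch_cover[OF cd]
      by (intro subbase_cover_in_uniformity) auto
    moreover have "openin R N" "openin R N'"
      unfolding N_def N'_def using uv sep by (simp_all add: openin_coordinate_preimage openin_branch)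
    moreover have "k \<in> N" "l \<in> N'" using k l p q by (simp_all add: N_def N'_def)
    moreover have "\<forall>A\<in>{branch X m c d, branch X m d c}. \<forall>x\<in>A. \<forall>y\<in>A. \<not> (\<nu> x \<in> N \<and> \<nu> y \<in> N')"
    proof (intro ballI notI, elim conjE)
      fix A x y assume A: "A \<in> {branch X m c d, branch X m d c}" "x \<in> A" "y \<in> A"
        and N: "\<nu> x \<in> N" "\<nu> y \<in> N'"
      have xy: "x \<in> X" "y \<in> X" using A by (auto simp: branch_def)
      have "m c x d = c" "m c y d = d"
        using N uv left right factor xy by (auto simp: N_def N'_def rf_map_coordinate) metis+
      then have "x \<notin> branch X m d c" "y \<notin> branch X m c d"
        using X xy median_swap13[of c x d] by (auto simp: branch_def)
      then show False using A by blast
    qed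
    ultimately show ?thesis by (intro bexI exI conjI)
  qed
qed (simp_all add: compact_rf_space Hausdorff_rf_space dense_rf_map rf_map_in_space)

end

section \<open>The two compactifications agree\<close>

lemma embedding_map_pullback:
  assumes "inj_on f X" "\<And>x. x \<in> X \<Longrightarrow> f x \<in> topspace K"
  shows "embedding_map (pullback_topology X f K) K f"
proof -
  have top: "topspace (pullback_topology X f K) = X"
    using assms(2) by (auto simp: topspace_pullback_topology)
  have cont: "continuous_map (pullback_topology X f K) K f"
    unfolding continuous_map_def top openin_pullback_topology using assms(2) by auto
  show ?thesis
    unfolding embedding_map_def
  proof (rule bijective_open_imp_homeomorphic_map)
    show "continuous_map (pullback_topology X f K)
        (subtopology K (f ` topspace (pullback_topology X f K))) f"
      using cont by (simp add: continuous_map_in_subtopology)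
    show "open_map (pullback_topology X f K)
        (subtopology K (f ` topspace (pullback_topology X f K))) f"
      unfolding open_map_def top
    proof (intro allI impI)
      fix W assume "openin (pullback_topology X f K) W"
      then obtain V where V: "openin K V" "W = f -` V \<inter> X"
        unfolding openin_pullback_topology by blast
      then have "f ` W = V \<inter> f ` X" by blast
      then show "openin (subtopology K (f ` X)) (f ` W)"
        using V(1) by (simp add: openin_subtopology_Int)
    qed
    show "f ` topspace (pullback_topology X f K) =
        topspace (subtopology K (f ` topspace (pullback_topology X f K)))"
      using assms(2) by (auto simp: top)
  qed (simp add: top assms(1))
qed

theorem proposition5p10:
  fixes \<sigma> :: "'a topology" and m :: "'a \<Rightarrow> 'a \<Rightarrow> 'a \<Rightarrow> 'a" and X :: "'a set"
  defines "X \<equiv> topspace \<sigma>"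
  assumes "topological_median_algebra \<sigma> m"
    and "\<And>u v. \<lbrakk>u \<in> X; v \<in> X\<rbrakk> \<Longrightarrow> compactin \<sigma> (median_interval X m u v)"
    and "T2m X m"
  shows "median_compactification (median_topology X m) m
           (rf_space \<sigma> m) (rf_median X m) (rf_map X m)
       \<and> median_compactification (median_topology X m) m
           (mmc_space X m) (mmc_median X m) (mmc_map X m)
       \<and> embedding_map (median_topology X m) (rf_space \<sigma> m) (rf_map X m)
       \<and> (\<exists>!h. h \<in> extensional (topspace (rf_space \<sigma> m)) \<and>
            compactification_iso X
              (rf_space \<sigma> m) (rf_median X m) (rf_map X m)
              (mmc_space X m) (mmc_median X m) (mmc_map X m) h)
       \<and> pullback_topology X (rf_map X m) (rf_space \<sigma> m) = median_topology X m"
proof -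
  interpret compact_interval_median \<sigma> m X
    using assms by unfold_locales auto
  interpret rf: cover_compactification X "median_uniformity X m" R \<nu>
    using rf_realises_median_uniformity assms(4) .
  have pullback: "pullback_topology X \<nu> R = median_topology X m"
    unfolding median_topology_def by (rule rf.pullback_eq_uniform_topology)
  have top: "topspace (median_topology X m) = X"
    using rf_map_in_space by (auto simp: pullback[symmetric] topspace_pullback_topology)
  have embedding: "embedding_map (median_topology X m) R \<nu>"
    using embedding_map_pullback[OF rf_map_inj rf_map_in_space] by (simp add: pullback)
  have embedding_continuous: "continuous_map (median_topology X m) R \<nu>"
    using homeomorphic_imp_continuous_map[OF embedding[unfolded embedding_map_def]]
    by (rule continuous_map_into_fulltopology)
  have rf_comp: "median_compactification (median_topology X m) m R M \<nu>"
    unfolding median_compactification_def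
    using topological_median_algebra_rf compact_rf_space embedding_continuous
      dense_rf_map rf_map_hom by (simp add: top)
  have trace_filter: "homeomorphic_map R (mmc_space X m) rf.trace_filter"
    unfolding mmc_space_def by (rule rf.homeomorphic_map_trace_filter)
  have trace_filter_map: "rf.trace_filter (\<nu> x) = mmc_map X m x" if "x \<in> X" for x
    unfolding mmc_map_def using rf.trace_filter_map_eq that .
  have transport:
    "median_compactification (median_topology X m) m (mmc_space X m) (mmc_median X m) (mmc_map X m)"
    "compactification_iso X R M \<nu> (mmc_space X m) (mmc_median X m) (mmc_map X m) rf.trace_filter"
    by (rule mmc_compactification_transport[OF median_algebra_axioms rf_comp top trace_filter],
        erule trace_filter_map)+
  have mmc_Hausdorff: "Hausdorff_space (mmc_space X m)"
    using transport(1) by (simp add: median_compactification_def topological_median_algebra_def)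
  have "\<exists>!h. h \<in> extensional (topspace R) \<and>
      compactification_iso X R M \<nu> (mmc_space X m) (mmc_median X m) (mmc_map X m) h"
  proof (rule ex1I)
    show "restrict rf.trace_filter (topspace R) \<in> extensional (topspace R) \<and>
      compactification_iso X R M \<nu> (mmc_space X m) (mmc_median X m) (mmc_map X m)
        (restrict rf.trace_filter (topspace R))"
      using compactification_iso_restrict[OF median_algebra_rf rf_map_in_space transport(2)] by simp
    then show "h = restrict rf.trace_filter (topspace R)"
      if "h \<in> extensional (topspace R) \<and>
        compactification_iso X R M \<nu> (mmc_space X m) (mmc_median X m) (mmc_map X m) h" for h
      using compactification_iso_unique[OF dense_rf_map mmc_Hausdorff] that by blast
  qed
  then show ?thesis using rf_comp transport(1) embedding pullback by blast
qed

end
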